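(* Let $\hat{\mathbb{B}}$ be the Ritter space. For any $\theta$-discrete subsets $A,B$ of $\hat{\mathbb{B}}$ and any bijection $f:A\to B$, there exists a homeomorphism $\bar f:\hat{\mathbb{B}}\to\hat{\mathbb{B}}$ such that $\bar f(a)=f(a)$ for all $a\in A$.
   Context: The Bing space $\mathbb{B}$ is the set $\{(x,y)\in\mathbb{Q}\times\mathbb{Q}: y\ge 0\}$ endowed with the topology consisting of all sets $U\subset\mathbb{B}$ such that for every $(a,b)\in U$ there exists $\varepsilon>0$ with $$\{(x,0)\in\mathbb{B}:|x-(a-b/\sqrt{3})|<\varepsilon\}\cup\{(x,0)\in\mathbb{B}:|x-(a+b/\sqrt{3})|<\varepsilon\}\subset U.$$ A subset $U$ of a topological space $X$ is regular open if $U$ coincides with the interior of its closure in $X$. The Ritter space $\hat{\mathbb{B}}$ is the set $\mathbb{B}$ endowed with the topology generated by the base consisting of all regular open subsets of the Bing space $\mathbb{B}$. A subset $D$ of a topological space $X$ is $\theta$-discrete in $X$ if each point $x\in X$ has a neighborhood $O_x\subset X$ whose closure $\overline{O_x}$ in $X$ contains at most one point of $D$. *)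

theory Defs
  imports "HOL-Analysis.Analysis"
begin

definition bing_set :: "(rat \<times> rat) set" where
  "bing_set = {(x, y). 0 \<le> y}"

text \<open>The rational points of the base line at distance less than \<open>\<epsilon>\<close> from one of the two feet
  \<open>a - b / sqrt 3\<close> and \<open>a + b / sqrt 3\<close>, the base vertices of the equilateral triangle with
  apex \<open>(a, b)\<close>.\<close>

definition bing_feet :: "real \<Rightarrow> rat \<times> rat \<Rightarrow> (rat \<times> rat) set" where
  "bing_feet \<epsilon> = (\<lambda>(a, b).
     {(x, 0) |x. \<bar>real_of_rat x - (real_of_rat a - real_of_rat b / sqrt 3)\<bar> < \<epsilon>} \<union>
     {(x, 0) |x. \<bar>real_of_rat x - (real_of_rat a + real_of_rat b / sqrt 3)\<bar> < \<epsilon>})"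

definition bing_open :: "(rat \<times> rat) set \<Rightarrow> bool" where
  "bing_open U \<longleftrightarrow> U \<subseteq> bing_set \<and> (\<forall>p\<in>U. \<exists>\<epsilon>>0. bing_feet \<epsilon> p \<subseteq> U)"

definition bing_space :: "(rat \<times> rat) topology" where
  "bing_space = topology bing_open"

definition regular_openin :: "'a topology \<Rightarrow> 'a set \<Rightarrow> bool" where
  "regular_openin X U \<longleftrightarrow> U \<subseteq> topspace X \<and> X interior_of (X closure_of U) = U"

definition ritter_space :: "(rat \<times> rat) topology" where
  "ritter_space = topology (arbitrary union_of regular_openin bing_space)"

definition theta_discrete_in :: "'a topology \<Rightarrow> 'a set \<Rightarrow> bool" where
  "theta_discrete_in X D \<longleftrightarrow> D \<subseteq> topspace X \<and>
     (\<forall>x\<in>topspace X. \<exists>N. N \<subseteq> topspace X \<and> x \<in> X interior_of N \<and>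
        (\<exists>\<^sub>\<le>\<^sub>1 d. d \<in> D \<and> d \<in> X closure_of N))"

text \<open>The constant \<open>topology\<close> is only meaningful on predicates satisfying \<open>istopology\<close>; the
  following facts check this for both spaces.\<close>

lemma bing_feet_mono: "\<delta> \<le> \<epsilon> \<Longrightarrow> bing_feet \<delta> p \<subseteq> bing_feet \<epsilon> p"
  by (cases p) (force simp: bing_feet_def)

lemma istopology_bing_open: "istopology bing_open"
  unfolding istopology_def
proof (intro conjI allI impI)
  fix S T assume S: "bing_open S" and T: "bing_open T"
  show "bing_open (S \<inter> T)"
    unfolding bing_open_def
  proof (intro conjI ballI)
    show "S \<inter> T \<subseteq> bing_set" using S by (auto simp: bing_open_def)
    fix p assume p: "p \<in> S \<inter> T"
    obtain d where d: "d > 0" "bing_feet d p \<subseteq> S" using S p by (auto simp: bing_open_def)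
    obtain e where e: "e > 0" "bing_feet e p \<subseteq> T" using T p by (auto simp: bing_open_def)
    have "bing_feet (min d e) p \<subseteq> S \<inter> T"
      using d e bing_feet_mono[of "min d e" d p] bing_feet_mono[of "min d e" e p] by auto
    then show "\<exists>\<epsilon>>0. bing_feet \<epsilon> p \<subseteq> S \<inter> T" using d e by (intro exI[of _ "min d e"]) auto
  qed
next
  fix K assume K: "\<forall>U\<in>K. bing_open U"
  show "bing_open (\<Union>K)"
    unfolding bing_open_def
  proof (intro conjI ballI)
    show "\<Union>K \<subseteq> bing_set" using K by (auto simp: bing_open_def)
    fix p assume "p \<in> \<Union>K"
    then obtain U where U: "U \<in> K" "p \<in> U" by blast
    then obtain e where "e > 0" "bing_feet e p \<subseteq> U" using K unfolding bing_open_def by blast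
    then show "\<exists>\<epsilon>>0. bing_feet \<epsilon> p \<subseteq> \<Union>K" using U by blast
  qed
qed

lemma openin_bing_space: "openin bing_space U \<longleftrightarrow> bing_open U"
  by (simp add: bing_space_def topology_inverse'[OF istopology_bing_open])

lemma topspace_bing_space [simp]: "topspace bing_space = bing_set"
proof -
  have "bing_open bing_set"
    unfolding bing_open_def by (auto simp: bing_feet_def bing_set_def intro!: exI[of _ 1])
  then show ?thesis
    by (auto simp: topspace_def openin_bing_space bing_open_def)
qed

lemma regular_openin_imp_openin: "regular_openin X U \<Longrightarrow> openin X U"
  by (metis regular_openin_def openin_interior_of)

lemma regular_openin_topspace: "regular_openin X (topspace X)"
  by (simp add: regular_openin_def)

lemma regular_openin_Int:
  assumes "regular_openin X S" "regular_openin X T"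
  shows "regular_openin X (S \<inter> T)"
proof -
  have "openin X (S \<inter> T)"
    using assms by (simp add: regular_openin_imp_openin openin_Int)
  then have "S \<inter> T \<subseteq> X interior_of (X closure_of (S \<inter> T))"
    by (simp add: closure_of_subset interior_of_maximal openin_subset)
  moreover have "X interior_of (X closure_of (S \<inter> T)) \<subseteq> X interior_of (X closure_of S)"
    and "X interior_of (X closure_of (S \<inter> T)) \<subseteq> X interior_of (X closure_of T)"
    by (simp_all add: interior_of_mono closure_of_mono)
  ultimately show ?thesis
    using assms by (auto simp: regular_openin_def)
qed

lemma openin_ritter_space:
  "openin ritter_space = arbitrary union_of regular_openin bing_space"
  unfolding ritter_space_def
  by (intro topology_inverse' istopology_base regular_openin_Int)

lemma topspace_ritter_space [simp]: "topspace ritter_space = bing_set"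
proof
  have "openin ritter_space bing_set"
    using regular_openin_topspace[of bing_space]
    by (simp add: openin_ritter_space union_of_inc arbitrary_def)
  then show "bing_set \<subseteq> topspace ritter_space"
    by (rule openin_subset)
  have "U \<subseteq> bing_set" if "openin ritter_space U" for U
    using that regular_openin_imp_openin[THEN openin_subset, of bing_space]
    unfolding openin_ritter_space union_of_def by fastforce
  then show "topspace ritter_space \<subseteq> bing_set"
    by simp
qed

end

theory Submission
  imports Defs
begin

text \<open>The point \<open>(a, b)\<close> of the Bing space is the conjugacy class of \<open>a + b / sqrt 3\<close> in the dense
  subfield \<open>K\<close> of the reals generated by \<open>sqrt 3\<close>, and a neighbourhood in the Ritter space consists
  of the classes all of whose elements are close to an element of the given class. A \<open>\<theta>\<close>-discrete
  set is therefore a union of classes that is closed and discrete in \<open>K\<close>. Off such a set, label the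
  elements of \<open>K\<close> in a locally constant way by shells around the classes that were removed. Since an
  element of \<open>K\<close> and its conjugate can be prescribed arbitrarily closely and independently, Cantor's
  back-and-forth method gives a bijection between the complements of the two sets which commutes with
  conjugation, respects the labels and is increasing on each label class. As label classes are open,
  it is a homeomorphism, and matching shells go to matching shells, so it extends continuously by
  \<open>f\<close>, even though \<open>f\<close> may send rational numbers to pairs of conjugate irrationals.\<close>

section \<open>The Bing plane as a quadratic field\<close>

text \<open>The domain is the whole plane rather than \<open>bing_set\<close>, so that both feet of
  a point are values of \<open>emb\<close>, at \<open>p\<close> and at \<open>mirror p\<close>.
  Since 1 / sqrt 3 = sqrt 3 / 3, these values are exactly the elements of the field generated by
  \<open>sqrt 3\<close>.\<close>

definition emb :: "rat \<times> rat \<Rightarrow> real" where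
  "emb p = of_rat (fst p) + of_rat (snd p) / sqrt 3"

definition mirror :: "rat \<times> rat \<Rightarrow> rat \<times> rat" where
  "mirror p = (fst p, - snd p)"

text \<open>This picks the representative of a conjugacy class that lies in
  \<open>bing_set\<close>.\<close>

definition upper :: "rat \<times> rat \<Rightarrow> rat \<times> rat" where
  "upper p = (fst p, \<bar>snd p\<bar>)"

definition feet :: "rat \<times> rat \<Rightarrow> (rat \<times> rat) set" where
  "feet p = {p, mirror p}"

text \<open>One foot near a foot of \<open>p\<close> already puts \<open>q\<close> into the Bing
  closure of the base points near the feet of \<open>p\<close>; lying in the interior of that
  closure takes both feet. Hence the quantifier over all feet of \<open>q\<close>.\<close>

definition nbhd :: "real \<Rightarrow> rat \<times> rat \<Rightarrow> (rat \<times> rat) set" where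
  "nbhd \<epsilon> p = {q \<in> bing_set. \<forall>z\<in>feet q. \<exists>w\<in>feet p. \<bar>emb z - emb w\<bar> < \<epsilon>}"

lemma mirror_mirror [simp]: "mirror (mirror p) = p"
  by (simp add: mirror_def)

lemma mirror_eq_iff [simp]: "mirror p = mirror q \<longleftrightarrow> p = q"
  by (metis mirror_mirror)

lemma mirror_rational [simp]: "mirror (a, 0) = (a, 0)"
  by (simp add: mirror_def)

lemma feet_mirror [simp]: "feet (mirror p) = feet p"
  by (auto simp: feet_def)

lemma self_in_feet [simp]: "p \<in> feet p"
  by (simp add: feet_def)

lemma mirror_in_feet_iff [simp]: "mirror z \<in> feet p \<longleftrightarrow> z \<in> feet p"
  by (auto simp: feet_def)

lemma finite_feet [simp]: "finite (feet p)"
  by (simp add: feet_def)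

lemma feet_eq: "z \<in> feet p \<Longrightarrow> feet z = feet p"
  by (auto simp: feet_def)

lemma upper_in_bing_set [simp]: "upper p \<in> bing_set"
  by (simp add: upper_def bing_set_def)

lemma upper_ident: "p \<in> bing_set \<Longrightarrow> upper p = p"
  by (auto simp: upper_def bing_set_def)

lemma feet_upper [simp]: "feet (upper p) = feet p"
  by (cases p) (auto simp: feet_def upper_def mirror_def abs_if)

lemma upper_feet: "z \<in> feet p \<Longrightarrow> upper z = upper p"
  by (auto simp: feet_def upper_def mirror_def)

lemma upper_cases: "upper p = p \<or> upper p = mirror p"
  by (cases p) (auto simp: upper_def mirror_def abs_if)

lemma feet_inject: "p \<in> bing_set \<Longrightarrow> q \<in> bing_set \<Longrightarrow> feet p = feet q \<Longrightarrow> p = q"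
  by (metis self_in_feet upper_feet upper_ident)

section \<open>Injectivity and density of the embedding\<close>

lemma rat_square_ne_3: "(x::rat)\<^sup>2 \<noteq> 3"
proof
  assume eq: "x\<^sup>2 = 3"
  obtain a b where q: "quotient_of x = (a, b)" by (cases "quotient_of x")
  have b: "b > 0" and cop: "coprime a b"
    using q quotient_of_denom_pos quotient_of_coprime by auto
  have "x = of_int a / of_int b" using q quotient_of_div by blast
  with eq b have "(of_int (a\<^sup>2) :: rat) = of_int (3 * b\<^sup>2)"
    by (simp add: power_divide field_simps)
  then have ab: "a\<^sup>2 = 3 * b\<^sup>2" by (simp only: of_int_eq_iff)
  have p3: "prime (3::int)" by simp
  have "3 dvd a\<^sup>2" using ab by simp
  then have a3: "3 dvd a" using p3 prime_dvd_power by blast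
  then obtain c where "a = 3 * c" by blast
  with ab have "b\<^sup>2 = 3 * c\<^sup>2" by (simp add: power2_eq_square)
  then have "3 dvd b\<^sup>2" by simp
  then have "3 dvd b" using p3 prime_dvd_power by blast
  then have "is_unit (3::int)" using coprime_common_divisor[OF cop a3] by simp
  then show False by simp
qed

lemma emb_diff: "emb p - emb q = emb (p - q)"
  by (simp add: emb_def of_rat_diff diff_divide_distrib)

text \<open>A zero (a, b) satisfies 3 a^2 = b^2, so a nonzero a would make b / a a rational square
  root of 3. As \<open>emb\<close> is additive, the trivial kernel gives injectivity.\<close>

lemma emb_eq_0_iff: "emb p = 0 \<longleftrightarrow> p = 0"
proof
  assume 0: "emb p = 0"
  obtain a b where p: "p = (a, b)" by (cases p)
  have "sqrt 3 * of_rat a = - of_rat b" using 0 unfolding p emb_def by (simp add: field_simps)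
  then have "(sqrt 3 * of_rat a)\<^sup>2 = (of_rat b)\<^sup>2" by simp
  then have "of_rat (3 * a\<^sup>2) = (of_rat (b\<^sup>2) :: real)"
    by (simp add: power_mult_distrib of_rat_mult of_rat_power)
  then have sq: "3 * a\<^sup>2 = b\<^sup>2" by (simp only: of_rat_eq_iff)
  have "a = 0"
  proof (rule ccontr)
    assume "a \<noteq> 0"
    then have "(b / a)\<^sup>2 = 3" using sq by (simp add: power_divide field_simps)
    then show False using rat_square_ne_3 by blast
  qed
  with sq p show "p = 0" by (simp add: zero_prod_def)
qed (simp add: emb_def)

lemma emb_eq_iff [simp]: "emb p = emb q \<longleftrightarrow> p = q"
  using emb_eq_0_iff[of "p - q"] by (simp flip: emb_diff)

lemma rational_approx:
  fixes s \<delta> :: real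
  assumes "\<delta> > 0"
  obtains a where "\<bar>emb (a, 0) - s\<bar> < \<delta>"
proof -
  obtain a where "s < of_rat a" "of_rat a < s + \<delta>"
    using of_rat_dense[of s "s + \<delta>"] assms by auto
  then show thesis by (intro that[of a]) (simp add: emb_def)
qed

text \<open>The two conjugates are u + v and u - v with u rational and v a rational multiple of 1 /
  sqrt 3. Both kinds of numbers are dense, so u can be taken near (s + t) / 2 and v, independently,
  near (s - t) / 2.\<close>

lemma weak_approximation:
  fixes s t \<delta> :: real
  assumes "\<delta> > 0"
  obtains z where "\<bar>emb z - s\<bar> < \<delta>" "\<bar>emb (mirror z) - t\<bar> < \<delta>"
proof -
  obtain a where a: "(s + t) / 2 < of_rat a" "of_rat a < (s + t) / 2 + \<delta> / 2"
    using of_rat_dense[of "(s + t) / 2" "(s + t) / 2 + \<delta> / 2"] assms by auto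
  have "sqrt 3 * ((s - t) / 2) < sqrt 3 * ((s - t) / 2 + \<delta> / 2)"
    using assms by (intro mult_strict_left_mono) auto
  from of_rat_dense[OF this] obtain b where "sqrt 3 * ((s - t) / 2) < of_rat b"
      "of_rat b < sqrt 3 * ((s - t) / 2 + \<delta> / 2)"
    by blast
  then have b: "(s - t) / 2 < of_rat b / sqrt 3" "of_rat b / sqrt 3 < (s - t) / 2 + \<delta> / 2"
    by (simp_all add: pos_less_divide_eq pos_divide_less_eq mult.commute)
  define u v :: real where "u = of_rat a" and "v = of_rat b / sqrt 3"
  have "\<bar>u + v - s\<bar> < \<delta>" "\<bar>u - v - t\<bar> < \<delta>"
    using a b unfolding u_def[symmetric] v_def[symmetric] by (auto simp: abs_less_iff field_simps)
  then show thesis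
    unfolding u_def v_def by (intro that[of "(a, b)"]) (auto simp: emb_def mirror_def of_rat_minus)
qed

lemma emb_dense:
  fixes s t :: real
  assumes "s < t"
  obtains z where "s < emb z" "emb z < t"
proof -
  obtain a where "s < of_rat a" "of_rat a < t"
    using of_rat_dense[OF assms] by auto
  then show thesis by (intro that[of "(a, 0)"]) (simp_all add: emb_def)
qed

text \<open>The field is countable and an interval is not. Radii of this kind make the boundaries of
  balls around field elements avoid the field.\<close>

lemma radius_outside_field:
  fixes m :: real
  assumes "m > 0"
  obtains r where "0 < r" "r < m" "r \<notin> range emb"
proof -
  have "countable (range emb)" by simp
  moreover have "uncountable {0<..<m}" using assms by (simp add: uncountable_open_interval)
  ultimately obtain r where "r \<in> {0<..<m}" "r \<notin> range emb"
    by (meson countable_subset subsetI)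
  then show thesis using that[of r] by simp
qed

section \<open>Neighbourhoods in the Ritter space\<close>

lemma bing_feet_iff:
  "q \<in> bing_feet \<epsilon> p \<longleftrightarrow> snd q = 0 \<and> (\<exists>w\<in>feet p. \<bar>emb q - emb w\<bar> < \<epsilon>)"
  by (cases p; cases q) (auto simp: bing_feet_def feet_def emb_def mirror_def of_rat_minus)

lemma rational_in_bing_feet:
  "z \<in> feet p \<Longrightarrow> \<bar>emb (a, 0) - emb z\<bar> < \<epsilon> \<Longrightarrow> (a, 0) \<in> bing_feet \<epsilon> p"
  by (auto simp: bing_feet_iff)

lemma feet_rational: "snd q = 0 \<Longrightarrow> feet q = {q}"
  by (cases q) (simp add: feet_def)

lemma rational_in_bing_set: "snd q = 0 \<Longrightarrow> q \<in> bing_set"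
  by (cases q) (simp add: bing_set_def)

lemma rational_in_nbhd:
  "snd q = 0 \<Longrightarrow> q \<in> nbhd \<epsilon> p \<longleftrightarrow> (\<exists>w\<in>feet p. \<bar>emb q - emb w\<bar> < \<epsilon>)"
  by (simp add: nbhd_def feet_rational rational_in_bing_set)

lemma self_in_nbhd: "p \<in> bing_set \<Longrightarrow> \<epsilon> > 0 \<Longrightarrow> p \<in> nbhd \<epsilon> p"
  by (auto simp: nbhd_def intro!: bexI)

text \<open>Each of the two feet of \<open>q\<close> satisfies a strict inequality, and the smaller
  of the two slacks serves for both.\<close>

lemma nbhd_room:
  assumes "q \<in> nbhd \<epsilon> p"
  obtains \<delta> where "\<delta> > 0"
    "\<And>z v. z \<in> feet q \<Longrightarrow> \<bar>v - emb z\<bar> < \<delta> \<Longrightarrow> \<exists>w\<in>feet p. \<bar>v - emb w\<bar> < \<epsilon>"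
proof -
  obtain w1 where w1: "w1 \<in> feet p" "\<bar>emb q - emb w1\<bar> < \<epsilon>"
    using assms self_in_feet[of q] unfolding nbhd_def by blast
  obtain w2 where w2: "w2 \<in> feet p" "\<bar>emb (mirror q) - emb w2\<bar> < \<epsilon>"
    using assms self_in_feet[of "mirror q"] unfolding nbhd_def feet_mirror by blast
  define \<delta> where "\<delta> = min (\<epsilon> - \<bar>emb q - emb w1\<bar>) (\<epsilon> - \<bar>emb (mirror q) - emb w2\<bar>)"
  show thesis
  proof (rule that[of \<delta>])
    show "\<delta> > 0" using w1 w2 by (simp add: \<delta>_def)
    fix z v assume "z \<in> feet q" and v: "\<bar>v - emb z\<bar> < \<delta>"
    then consider "z = q" | "z = mirror q" by (auto simp: feet_def)
    then show "\<exists>w\<in>feet p. \<bar>v - emb w\<bar> < \<epsilon>"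
    proof cases
      case 1
      have "\<bar>v - emb w1\<bar> < \<epsilon>" using v unfolding 1 \<delta>_def by linarith
      then show ?thesis using w1 by blast
    next
      case 2
      have "\<bar>v - emb w2\<bar> < \<epsilon>" using v unfolding 2 \<delta>_def by linarith
      then show ?thesis using w2 by blast
    qed
  qed
qed

section \<open>Bing closures and a neighbourhood base of the Ritter space\<close>

lemma bing_open_nbhd: "bing_open (nbhd \<epsilon> p)"
  unfolding bing_open_def
proof (intro conjI ballI)
  show "nbhd \<epsilon> p \<subseteq> bing_set" by (auto simp: nbhd_def)
  fix q assume "q \<in> nbhd \<epsilon> p"
  then obtain \<delta> where "\<delta> > 0"
    "\<And>z v. z \<in> feet q \<Longrightarrow> \<bar>v - emb z\<bar> < \<delta> \<Longrightarrow> \<exists>w\<in>feet p. \<bar>v - emb w\<bar> < \<epsilon>"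
    using nbhd_room by blast
  then show "\<exists>\<epsilon>'>0. bing_feet \<epsilon>' q \<subseteq> nbhd \<epsilon> p"
    by (intro exI[of _ \<delta>]) (auto simp: bing_feet_iff rational_in_nbhd)
qed

text \<open>Near each foot of \<open>q\<close> there is a rational point of the closure, and near
  that point a point \<open>y\<close> of \<open>nbhd \<epsilon> p\<close>. The distances \<epsilon>
  / 2, \<epsilon> / 2 and \<epsilon> add up to the factor 2.\<close>

lemma interior_closure_nbhd_subset:
  "bing_space interior_of (bing_space closure_of nbhd \<epsilon> p) \<subseteq> nbhd (2 * \<epsilon>) p"
proof
  fix q assume q: "q \<in> bing_space interior_of (bing_space closure_of nbhd \<epsilon> p)"
  then obtain U where U: "bing_open U" "q \<in> U" "U \<subseteq> bing_space closure_of nbhd \<epsilon> p"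
    by (auto simp: interior_of_def openin_bing_space)
  then obtain \<delta> where \<delta>: "\<delta> > 0" "bing_feet \<delta> q \<subseteq> bing_space closure_of nbhd \<epsilon> p"
    unfolding bing_open_def by blast
  have qX: "q \<in> bing_set" using U by (auto simp: bing_open_def)
  \<comment> \<open>The statement leaves the sign of \<epsilon> open; the existence of
    \<open>q\<close> forces it to be positive.\<close>
  have "nbhd \<epsilon> p \<noteq> {}" using U by fastforce
  then have \<epsilon>: "\<epsilon> > 0" by (force simp: nbhd_def feet_def)
  show "q \<in> nbhd (2 * \<epsilon>) p"
    unfolding nbhd_def
  proof (intro CollectI conjI qX ballI)
    fix z assume z: "z \<in> feet q"
    obtain a where a: "\<bar>emb (a, 0) - emb z\<bar> < min \<delta> (\<epsilon> / 2)"
      using rational_approx[of "min \<delta> (\<epsilon> / 2)"] \<delta> \<epsilon> by (metis half_gt_zero min_less_iff_conj)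
    have "(a, 0) \<in> bing_space closure_of nbhd \<epsilon> p"
      using a z by (intro subsetD[OF \<delta>(2)] rational_in_bing_feet[of z]) auto
    moreover have "openin bing_space (nbhd (\<epsilon> / 2) (a, 0))"
      by (simp add: openin_bing_space bing_open_nbhd)
    moreover have "(a, 0) \<in> nbhd (\<epsilon> / 2) (a, 0)"
      using \<epsilon> by (simp add: self_in_nbhd rational_in_bing_set)
    ultimately obtain y where y: "y \<in> nbhd \<epsilon> p" "y \<in> nbhd (\<epsilon> / 2) (a, 0)"
      by (auto simp: in_closure_of)
    obtain w where w: "w \<in> feet p" "\<bar>emb y - emb w\<bar> < \<epsilon>"
      using y(1) self_in_feet[of y] unfolding nbhd_def by blast
    have "\<bar>emb y - emb (a, 0)\<bar> < \<epsilon> / 2"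
      using y(2) by (auto simp: nbhd_def feet_rational)
    then have "\<bar>emb z - emb w\<bar> < 2 * \<epsilon>" using w a by linarith
    then show "\<exists>w\<in>feet p. \<bar>emb z - emb w\<bar> < 2 * \<epsilon>" using w by blast
  qed
qed

lemma regular_openin_interior_closure:
  "regular_openin X (X interior_of (X closure_of S))"
proof -
  let ?V = "X interior_of (X closure_of S)"
  have "X interior_of (X closure_of ?V) \<subseteq> ?V"
    by (metis closure_of_closure_of closure_of_mono interior_of_mono interior_of_subset)
  moreover have "?V \<subseteq> X interior_of (X closure_of ?V)"
    by (simp add: closure_of_subset interior_of_maximal interior_of_subset_topspace)
  ultimately show ?thesis
    by (simp add: regular_openin_def interior_of_subset_topspace)
qed

text \<open>An open set around a point \<open>q\<close> of \<open>nbhd \<epsilon> p\<close> contains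
  all rationals close to a foot of \<open>q\<close>, and these lie in
  \<open>bing_feet \<epsilon> p\<close>. So \<open>nbhd \<epsilon> p\<close> lies in the closure of
  \<open>U\<close> and, being open, in its interior, which is \<open>U\<close>.\<close>

lemma regular_openin_bing_nbhd:
  assumes U: "regular_openin bing_space U" and p: "p \<in> U"
  shows "\<exists>\<epsilon>>0. nbhd \<epsilon> p \<subseteq> U"
proof -
  have "bing_open U"
    using U regular_openin_imp_openin openin_bing_space by blast
  then obtain \<epsilon> where \<epsilon>: "\<epsilon> > 0" "bing_feet \<epsilon> p \<subseteq> U" using p by (auto simp: bing_open_def)
  have "nbhd \<epsilon> p \<subseteq> bing_space closure_of U"
  proof
    fix q assume q: "q \<in> nbhd \<epsilon> p"
    have "\<exists>y\<in>U. y \<in> V" if V: "q \<in> V" "openin bing_space V" for V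
    proof -
      obtain \<delta> where \<delta>: "\<delta> > 0" "bing_feet \<delta> q \<subseteq> V"
        using V by (auto simp: bing_open_def openin_bing_space)
      obtain \<eta> where \<eta>: "\<eta> > 0"
        "\<And>z v. z \<in> feet q \<Longrightarrow> \<bar>v - emb z\<bar> < \<eta> \<Longrightarrow> \<exists>w\<in>feet p. \<bar>v - emb w\<bar> < \<epsilon>"
        using nbhd_room[OF q] by blast
      obtain a where a: "\<bar>emb (a, 0) - emb q\<bar> < min \<delta> \<eta>"
        using rational_approx[of "min \<delta> \<eta>"] \<delta> \<eta> by (metis min_less_iff_conj)
      have "(a, 0) \<in> V" using a by (intro subsetD[OF \<delta>(2)] rational_in_bing_feet[of q]) auto
      moreover have "(a, 0) \<in> U" using a \<eta>(2)[of q] \<epsilon>(2) by (auto simp: bing_feet_iff)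
      ultimately show ?thesis by blast
    qed
    moreover have "q \<in> bing_set" using q by (simp add: nbhd_def)
    ultimately show "q \<in> bing_space closure_of U"
      unfolding in_closure_of topspace_bing_space by blast
  qed
  then have "nbhd \<epsilon> p \<subseteq> bing_space interior_of (bing_space closure_of U)"
    by (simp add: interior_of_maximal openin_bing_space bing_open_nbhd)
  then show ?thesis using U \<epsilon> by (auto simp: regular_openin_def)
qed

text \<open>The sets \<open>nbhd \<epsilon> p\<close> form a neighbourhood base without having to be
  regular open: the interior of the closure of \<open>nbhd (\<epsilon> / 2) p\<close> is regular
  open and squeezed between \<open>nbhd (\<epsilon> / 2) p\<close> and
  \<open>nbhd \<epsilon> p\<close>.\<close>

lemma openin_ritter_iff:
  "openin ritter_space U \<longleftrightarrow> U \<subseteq> bing_set \<and> (\<forall>p\<in>U. \<exists>\<epsilon>>0. nbhd \<epsilon> p \<subseteq> U)"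
proof (intro iffI conjI ballI)
  assume U: "openin ritter_space U"
  then show "U \<subseteq> bing_set" using openin_subset by fastforce
  fix p assume "p \<in> U"
  with U obtain W where "regular_openin bing_space W" "p \<in> W" "W \<subseteq> U"
    by (auto simp: openin_ritter_space arbitrary_union_of_alt)
  then show "\<exists>\<epsilon>>0. nbhd \<epsilon> p \<subseteq> U" using regular_openin_bing_nbhd by (meson subset_trans)
next
  assume U: "U \<subseteq> bing_set \<and> (\<forall>p\<in>U. \<exists>\<epsilon>>0. nbhd \<epsilon> p \<subseteq> U)"
  have "\<exists>W. regular_openin bing_space W \<and> p \<in> W \<and> W \<subseteq> U" if p: "p \<in> U" for p
  proof -
    obtain \<epsilon> where \<epsilon>: "\<epsilon> > 0" "nbhd \<epsilon> p \<subseteq> U" using U p by blast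
    let ?W = "bing_space interior_of (bing_space closure_of nbhd (\<epsilon> / 2) p)"
    have "?W \<subseteq> U" using interior_closure_nbhd_subset[of "\<epsilon> / 2" p] \<epsilon> by simp
    moreover have "nbhd (\<epsilon> / 2) p \<subseteq> ?W"
      by (intro interior_of_maximal closure_of_subset)
        (simp_all add: openin_bing_space bing_open_nbhd, auto simp: nbhd_def)
    then have "p \<in> ?W" using self_in_nbhd[of p "\<epsilon> / 2"] \<epsilon> U p by auto
    ultimately show ?thesis using regular_openin_interior_closure by blast
  qed
  then show "openin ritter_space U"
    by (auto simp: openin_ritter_space arbitrary_union_of_alt)
qed

lemma continuous_map_ritterI:
  assumes "g \<in> bing_set \<rightarrow> bing_set"
    and "\<And>p \<epsilon>. p \<in> bing_set \<Longrightarrow> \<epsilon> > 0 \<Longrightarrow> \<exists>\<delta>>0. g ` nbhd \<delta> p \<subseteq> nbhd \<epsilon> (g p)"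
  shows "continuous_map ritter_space ritter_space g"
  unfolding continuous_map_def topspace_ritter_space
proof (intro conjI allI impI assms(1))
  fix U assume U: "openin ritter_space U"
  show "openin ritter_space {x \<in> bing_set. g x \<in> U}"
    unfolding openin_ritter_iff
  proof (intro conjI ballI)
    fix p assume p: "p \<in> {x \<in> bing_set. g x \<in> U}"
    then obtain \<epsilon> where \<epsilon>: "\<epsilon> > 0" "nbhd \<epsilon> (g p) \<subseteq> U" using U by (auto simp: openin_ritter_iff)
    obtain \<delta> where "\<delta> > 0" "g ` nbhd \<delta> p \<subseteq> nbhd \<epsilon> (g p)"
      using assms(2) p \<epsilon>(1) by blast
    then show "\<exists>\<epsilon>>0. nbhd \<epsilon> p \<subseteq> {x \<in> bing_set. g x \<in> U}"
      using \<epsilon> by (intro exI[of _ \<delta>]) (auto simp: nbhd_def)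
  qed auto
qed

text \<open>This turns \<theta>-discreteness into a statement about the reals. For the closure of a
  neighbourhood to contain \<open>d\<close>, one foot of \<open>d\<close> near \<open>z\<close>
  suffices. Hence only one \<open>d\<close> has feet near \<open>z\<close>, which leaves finitely
  many feet to keep away from.\<close>

lemma theta_discrete_isolated:
  assumes D: "theta_discrete_in ritter_space D"
  shows "\<exists>\<epsilon>>0. \<forall>d\<in>D. \<forall>w\<in>feet d. w \<noteq> z \<longrightarrow> \<epsilon> \<le> \<bar>emb w - emb z\<bar>"
proof -
  obtain N where N: "N \<subseteq> bing_set" "upper z \<in> ritter_space interior_of N"
    "\<exists>\<^sub>\<le>\<^sub>1 d. d \<in> D \<and> d \<in> ritter_space closure_of N"
    using D unfolding theta_discrete_in_def topspace_ritter_space by (meson upper_in_bing_set)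
  then obtain \<epsilon> where \<epsilon>: "\<epsilon> > 0" "nbhd \<epsilon> (upper z) \<subseteq> N"
    by (auto simp: interior_of_def openin_ritter_iff)
  \<comment> \<open>Rational points tending to the foot \<open>w\<close> tend to \<open>d\<close> in
    the Ritter space, even if the other foot of \<open>d\<close> is far from
    \<open>z\<close>.\<close>
  have closure: "d \<in> ritter_space closure_of N"
    if d: "d \<in> D" "w \<in> feet d" "\<bar>emb w - emb z\<bar> < \<epsilon>" for d w
  proof -
    have "\<exists>y\<in>N. y \<in> V" if V: "d \<in> V" "openin ritter_space V" for V
    proof -
      obtain \<delta> where \<delta>: "\<delta> > 0" "nbhd \<delta> d \<subseteq> V" using V by (auto simp: openin_ritter_iff)
      obtain a where a: "\<bar>emb (a, 0) - emb w\<bar> < min \<delta> (\<epsilon> - \<bar>emb w - emb z\<bar>)"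
        using rational_approx[of "min \<delta> (\<epsilon> - \<bar>emb w - emb z\<bar>)"] \<delta> d
        by (metis diff_gt_0_iff_gt min_less_iff_conj)
      have "(a, 0) \<in> nbhd \<delta> d" using a d by (auto simp: rational_in_nbhd)
      moreover have "\<bar>emb (a, 0) - emb z\<bar> < \<epsilon>" using a by linarith
      then have "(a, 0) \<in> nbhd \<epsilon> (upper z)" by (auto simp: rational_in_nbhd)
      ultimately show ?thesis using \<delta> \<epsilon> by blast
    qed
    moreover have "d \<in> bing_set" using D d by (auto simp: theta_discrete_in_def)
    ultimately show ?thesis unfolding in_closure_of topspace_ritter_space by blast
  qed
  define C where "C = {w. \<exists>d\<in>D. w \<in> feet d \<and> w \<noteq> z \<and> \<bar>emb w - emb z\<bar> < \<epsilon>}"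
  have "finite C"
  proof (cases "C = {}")
    case False
    then obtain d w where "d \<in> D" "w \<in> feet d" "\<bar>emb w - emb z\<bar> < \<epsilon>"
      by (auto simp: C_def)
    then have "C \<subseteq> feet d"
      using closure N(3) unfolding C_def Uniq_def by blast
    then show ?thesis using finite_subset finite_feet by blast
  qed simp
  \<comment> \<open>Inserting \<epsilon> covers an empty \<open>C\<close> and bounds the distance to
    the feet outside \<open>C\<close>.\<close>
  define \<eta> where "\<eta> = Min (insert \<epsilon> ((\<lambda>w. \<bar>emb w - emb z\<bar>) ` C))"
  have "\<eta> > 0" using \<open>finite C\<close> \<epsilon> by (auto simp: \<eta>_def C_def)
  moreover have "\<eta> \<le> \<bar>emb w - emb z\<bar>" if "d \<in> D" "w \<in> feet d" "w \<noteq> z" for d w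
  proof (cases "\<bar>emb w - emb z\<bar> < \<epsilon>")
    case True
    then show ?thesis using that \<open>finite C\<close> unfolding \<eta>_def by (intro Min_le) (auto simp: C_def)
  next
    case False
    moreover have "\<eta> \<le> \<epsilon>" using \<open>finite C\<close> unfolding \<eta>_def by (intro Min_le) auto
    ultimately show ?thesis by linarith
  qed
  ultimately show ?thesis by blast
qed

section \<open>Locally constant labellings off a discrete set\<close>

text \<open>The clause \<open>y \<in> S\<close>, for \<open>y\<close> ranging over the whole field,
  makes \<open>S\<close> open, so the label classes in \<open>S\<close> are open as well.\<close>

definition loc_const :: "(rat \<times> rat) set \<Rightarrow> (rat \<times> rat \<Rightarrow> 'l) \<Rightarrow> bool" where
  "loc_const S lab \<longleftrightarrow>
     (\<forall>z\<in>S. \<exists>\<epsilon>>0. \<forall>y. \<bar>emb y - emb z\<bar> < \<epsilon> \<longrightarrow> y \<in> S \<and> lab y = lab z)"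

text \<open>The removed classes form a family rather than a set, so that the two sides can share one
  index set and hence one set of labels.\<close>

definition off :: "('i \<Rightarrow> rat \<times> rat) \<Rightarrow> 'i set \<Rightarrow> (rat \<times> rat) set" where
  "off c I = {z. \<forall>i\<in>I. z \<notin> feet (c i)}"

text \<open>A label \<open>(i, n)\<close> with large \<open>n\<close> means being close to one of the feet of \<open>c i\<close>.\<close>

definition labelling :: "('i \<Rightarrow> rat \<times> rat) \<Rightarrow> 'i set \<Rightarrow> (rat \<times> rat \<Rightarrow> 'i \<times> nat) \<Rightarrow> bool" where
  "labelling c I lab \<longleftrightarrow>
     loc_const (off c I) lab \<and> lab ` off c I = I \<times> {1..} \<and>
     (\<forall>i\<in>I. \<forall>N. \<exists>\<epsilon>>0. \<forall>w\<in>feet (c i). \<forall>z. \<bar>emb z - emb w\<bar> < \<epsilon> \<longrightarrow>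
        z = w \<or> z \<in> off c I \<and> fst (lab z) = i \<and> N \<le> snd (lab z)) \<and>
     (\<forall>i\<in>I. \<forall>\<epsilon>>0. \<exists>N. \<forall>z\<in>off c I. fst (lab z) = i \<and> N \<le> snd (lab z) \<longrightarrow>
        (\<exists>w\<in>feet (c i). \<bar>emb z - emb w\<bar> < \<epsilon>))"

lemma mirror_in_off [simp]: "mirror z \<in> off c I \<longleftrightarrow> z \<in> off c I"
  by (simp add: off_def)

section \<open>Shells around the removed classes\<close>

lemma of_int_mult_emb_in_range: "of_int k * \<bar>emb p\<bar> \<in> range emb"
proof -
  have "of_int j * emb p = emb (of_int j * fst p, of_int j * snd p)" for j
    by (simp add: emb_def of_rat_mult algebra_simps)
  then have "of_int j * emb p \<in> range emb" for j by blast
  from this[of k] this[of "-k"] show ?thesis by (cases "emb p \<ge> 0") auto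
qed

text \<open>A non-integral quotient lies strictly between consecutive integers, and division by a
  positive number is continuous.\<close>

lemma floor_quotient_locally_constant:
  fixes r d :: real
  assumes "d > 0" and "r / d \<notin> \<int>"
  shows "\<exists>\<delta>>0. \<forall>d'. \<bar>d' - d\<bar> < \<delta> \<longrightarrow> d' > 0 \<and> \<lfloor>r / d'\<rfloor> = \<lfloor>r / d\<rfloor>"
proof -
  have lim: "((\<lambda>t. r / t) \<longlongrightarrow> r / d) (nhds d)"
    using assms by (intro tendsto_divide tendsto_const filterlim_ident) auto
  have "of_int \<lfloor>r / d\<rfloor> < r / d" "r / d < of_int \<lfloor>r / d\<rfloor> + 1"
    using assms(2) floor_correct[of "r / d"] by (auto simp: less_le Ints_def)
  then have "eventually (\<lambda>t. of_int \<lfloor>r / d\<rfloor> < r / t) (nhds d)"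
    "eventually (\<lambda>t. r / t < of_int \<lfloor>r / d\<rfloor> + 1) (nhds d)"
    "eventually (\<lambda>t. 0 < t) (nhds d)"
    using order_tendstoD[OF lim] order_tendstoD(1)[OF filterlim_ident assms(1)] by auto
  then have "eventually (\<lambda>t. t > 0 \<and> \<lfloor>r / t\<rfloor> = \<lfloor>r / d\<rfloor>) (nhds d)"
    by eventually_elim (auto simp: floor_eq_iff)
  then show ?thesis by (simp add: eventually_nhds_metric dist_real_def)
qed

text \<open>Three demands on the radii: below half the isolation distance, so that balls around
  distinct feet are disjoint; outside the field, so that no field element is on a boundary; and
  below 1 / (1 + code of \<open>c i\<close>), so that only finitely many exceed a given
  bound.\<close>

lemma separating_radii:
  assumes c: "inj_on c I" and D: "theta_discrete_in ritter_space (c ` I)"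
  shows "\<exists>\<rho> :: 'i \<Rightarrow> real.
    (\<forall>i\<in>I. 0 < \<rho> i \<and> \<rho> i \<notin> range emb \<and> \<rho> i < 1 / (1 + real (to_nat (c i)))) \<and>
    (\<forall>i\<in>I. \<forall>j\<in>I. \<forall>v\<in>feet (c i). \<forall>w\<in>feet (c j). \<forall>z.
       \<bar>emb z - emb v\<bar> < \<rho> i \<and> \<bar>emb z - emb w\<bar> < \<rho> j \<longrightarrow> i = j \<and> v = w)"
proof -
  have "\<exists>\<epsilon>>0. \<forall>v\<in>feet (c i). \<forall>j\<in>I. \<forall>w\<in>feet (c j). w \<noteq> v \<longrightarrow> \<epsilon> \<le> \<bar>emb w - emb v\<bar>" for i
  proof -
    obtain \<epsilon>1 where "\<epsilon>1 > 0"
      "\<forall>d\<in>c ` I. \<forall>w\<in>feet d. w \<noteq> c i \<longrightarrow> \<epsilon>1 \<le> \<bar>emb w - emb (c i)\<bar>"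
      using theta_discrete_isolated[OF D] by blast
    moreover obtain \<epsilon>2 where "\<epsilon>2 > 0"
      "\<forall>d\<in>c ` I. \<forall>w\<in>feet d. w \<noteq> mirror (c i) \<longrightarrow> \<epsilon>2 \<le> \<bar>emb w - emb (mirror (c i))\<bar>"
      using theta_discrete_isolated[OF D] by blast
    ultimately show ?thesis
      by (intro exI[of _ "min \<epsilon>1 \<epsilon>2"]) (auto simp: feet_def min_le_iff_disj)
  qed
  then obtain \<epsilon> where \<epsilon>_all: "\<forall>i. \<epsilon> i > 0 \<and>
      (\<forall>v\<in>feet (c i). \<forall>j\<in>I. \<forall>w\<in>feet (c j). w \<noteq> v \<longrightarrow> \<epsilon> i \<le> \<bar>emb w - emb v\<bar>)"
    using choice[where Q = "\<lambda>i \<epsilon>. \<epsilon> > 0 \<and>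
      (\<forall>v\<in>feet (c i). \<forall>j\<in>I. \<forall>w\<in>feet (c j). w \<noteq> v \<longrightarrow> \<epsilon> \<le> \<bar>emb w - emb v\<bar>)"]
    by blast
  then have \<epsilon>: "\<And>i. \<epsilon> i > 0"
    "\<And>i j v w. v \<in> feet (c i) \<Longrightarrow> j \<in> I \<Longrightarrow> w \<in> feet (c j) \<Longrightarrow> w \<noteq> v \<Longrightarrow>
       \<epsilon> i \<le> \<bar>emb w - emb v\<bar>"
    by blast+
  have "\<exists>r. 0 < r \<and> r < min (\<epsilon> i / 2) (1 / (1 + real (to_nat (c i)))) \<and> r \<notin> range emb" for i
  proof -
    have "0 < min (\<epsilon> i / 2) (1 / (1 + real (to_nat (c i))))"
      using \<epsilon>(1)[of i] by (simp add: add_pos_nonneg)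
    then show ?thesis by (rule radius_outside_field) blast
  qed
  then obtain \<rho> where
    \<rho>: "\<And>i. 0 < \<rho> i \<and> \<rho> i < min (\<epsilon> i / 2) (1 / (1 + real (to_nat (c i)))) \<and> \<rho> i \<notin> range emb"
    by metis
  have "\<forall>i\<in>I. \<forall>j\<in>I. \<forall>v\<in>feet (c i). \<forall>w\<in>feet (c j). \<forall>z.
       \<bar>emb z - emb v\<bar> < \<rho> i \<and> \<bar>emb z - emb w\<bar> < \<rho> j \<longrightarrow> i = j \<and> v = w"
  proof (intro ballI allI impI, elim conjE)
    fix i j v w z
    assume ij: "i \<in> I" "j \<in> I" and vw: "v \<in> feet (c i)" "w \<in> feet (c j)"
      and z: "\<bar>emb z - emb v\<bar> < \<rho> i" "\<bar>emb z - emb w\<bar> < \<rho> j"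
    \<comment> \<open>Otherwise the distance of v and w would be below \<rho> i + \<rho> j, hence
      below (\<epsilon> i + \<epsilon> j) / 2, while both \<epsilon> i and \<epsilon> j are at most
      that distance.\<close>
    have "v = w"
    proof (rule ccontr)
      assume "v \<noteq> w"
      then have "\<epsilon> i \<le> \<bar>emb w - emb v\<bar>" "\<epsilon> j \<le> \<bar>emb v - emb w\<bar>"
        using \<epsilon>(2)[OF vw(1) ij(2) vw(2)] \<epsilon>(2)[OF vw(2) ij(1) vw(1)] by auto
      then show False using z \<rho>[of i] \<rho>[of j] by linarith
    qed
    moreover have "c i \<in> bing_set" "c j \<in> bing_set"
      using D ij by (auto simp: theta_discrete_in_def)
    ultimately have "c i = c j" using vw by (metis feet_eq feet_inject)
    then show "i = j \<and> v = w" using \<open>v = w\<close> c ij by (auto dest: inj_onD)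
  qed
  moreover have "\<forall>i\<in>I. 0 < \<rho> i \<and> \<rho> i \<notin> range emb \<and> \<rho> i < 1 / (1 + real (to_nat (c i)))"
    using \<rho> by simp
  ultimately show ?thesis by (intro exI[of _ \<rho>] conjI)
qed

text \<open>A point at distance d < \<rho> i from a foot of \<open>c i\<close> gets the label (i, n)
  with n the floor of \<rho> i / d, that is, \<rho> i / (n + 1) < d \<le> \<rho> i / n. The shells
  shrink to the feet as n grows, and the feet of one class share their labels.\<close>

lemma labelling_exists:
  assumes c: "inj_on c I" and D: "theta_discrete_in ritter_space (c ` I)" and i0: "i0 \<in> I"
  shows "\<exists>lab. labelling c I lab"
proof -
  obtain \<rho> :: "'a \<Rightarrow> real" where
    \<rho>: "\<forall>i\<in>I. 0 < \<rho> i \<and> \<rho> i \<notin> range emb \<and> \<rho> i < 1 / (1 + real (to_nat (c i)))"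
    and unique: "\<forall>i\<in>I. \<forall>j\<in>I. \<forall>v\<in>feet (c i). \<forall>w\<in>feet (c j). \<forall>z.
       \<bar>emb z - emb v\<bar> < \<rho> i \<and> \<bar>emb z - emb w\<bar> < \<rho> j \<longrightarrow> i = j \<and> v = w"
    using separating_radii[OF c D] by (elim exE conjE)
  then have pos: "\<And>i. i \<in> I \<Longrightarrow> 0 < \<rho> i" and irr: "\<And>i. i \<in> I \<Longrightarrow> \<rho> i \<notin> range emb"
    and small: "\<And>i. i \<in> I \<Longrightarrow> \<rho> i < 1 / (1 + real (to_nat (c i)))"
    by auto
  define covers where "covers z i w \<longleftrightarrow> i \<in> I \<and> w \<in> feet (c i) \<and> \<bar>emb z - emb w\<bar> < \<rho> i" for z i w
  \<comment> \<open>At most one pair covers \<open>z\<close>, so the choice is determined. The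
    default reuses the label (i0, 1), which keeps the set of labels equal to
    \<open>I \<times> {1..}\<close>.\<close>
  define lab where "lab z = (if \<exists>i w. covers z i w
      then SOME l. \<exists>i w. covers z i w \<and> l = (i, nat \<lfloor>\<rho> i / \<bar>emb z - emb w\<bar>\<rfloor>)
      else (i0, 1))" for z
  have covers_unique: "j = i \<and> v = w" if "covers z i w" "covers z j v" for z i w j v
    using that unique[rule_format, of j i v w z] by (simp add: covers_def)
  have lab_covered: "lab z = (i, nat \<lfloor>\<rho> i / \<bar>emb z - emb w\<bar>\<rfloor>)" if "covers z i w" for z i w
  proof -
    have "(SOME l. \<exists>i w. covers z i w \<and> l = (i, nat \<lfloor>\<rho> i / \<bar>emb z - emb w\<bar>\<rfloor>)) =
        (i, nat \<lfloor>\<rho> i / \<bar>emb z - emb w\<bar>\<rfloor>)"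
    proof (rule some_equality)
      fix l assume "\<exists>i w. covers z i w \<and> l = (i, nat \<lfloor>\<rho> i / \<bar>emb z - emb w\<bar>\<rfloor>)"
      then obtain j v where "covers z j v" "l = (j, nat \<lfloor>\<rho> j / \<bar>emb z - emb v\<bar>\<rfloor>)" by blast
      with covers_unique[OF that] show "l = (i, nat \<lfloor>\<rho> i / \<bar>emb z - emb w\<bar>\<rfloor>)" by metis
    qed (use that in blast)
    moreover have "\<exists>i w. covers z i w" using that by blast
    ultimately show ?thesis unfolding lab_def by simp
  qed
  have lab_free: "lab z = (i0, 1)" if "\<And>i w. \<not> covers z i w" for z
    using that by (simp add: lab_def)
  \<comment> \<open>A removed element is the centre of a ball that covers it, so a second centre
    covering it would contradict uniqueness.\<close>
  have covered_off: "z \<in> off c I" if z: "covers z i w" "z \<noteq> w" for z i w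
  proof -
    have "z \<notin> feet (c j)" if "j \<in> I" for j
    proof
      assume "z \<in> feet (c j)"
      then have "covers z j z" using pos that by (simp add: covers_def)
      then show False using covers_unique z by blast
    qed
    then show ?thesis by (simp add: off_def)
  qed
  have covered_ne: "z \<noteq> w" if "covers z i w" "z \<in> off c I" for z i w
    using that by (auto simp: off_def covers_def)
  have "\<exists>\<epsilon>>0. \<forall>y. \<bar>emb y - emb z\<bar> < \<epsilon> \<longrightarrow> y \<in> off c I \<and> lab y = lab z"
    if z: "z \<in> off c I" for z
  proof (cases "\<exists>i w. covers z i w")
    case True
    then obtain i w where iw: "covers z i w" by blast
    let ?d = "\<bar>emb z - emb w\<bar>"
    have d: "?d > 0" using covered_ne[OF iw z] by simp
    \<comment> \<open>An integral quotient would make \<rho> i an integer multiple of a distance in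
      the field, hence an element of the field.\<close>
    have "\<rho> i / ?d \<notin> \<int>"
    proof
      assume "\<rho> i / ?d \<in> \<int>"
      then obtain k where "\<rho> i / ?d = of_int k" by (auto simp: Ints_def)
      then have "\<rho> i = of_int k * \<bar>emb (z - w)\<bar>" using d by (simp add: field_simps flip: emb_diff)
      then show False using irr iw of_int_mult_emb_in_range unfolding covers_def by metis
    qed
    then obtain \<delta> where \<delta>: "\<delta> > 0"
      "\<And>d'. \<bar>d' - ?d\<bar> < \<delta> \<Longrightarrow> d' > 0 \<and> \<lfloor>\<rho> i / d'\<rfloor> = \<lfloor>\<rho> i / ?d\<rfloor>"
      using floor_quotient_locally_constant[OF d] by blast
    \<comment> \<open>The bound \<delta> fixes the shell, and \<rho> i - ?d keeps \<open>y\<close>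
      inside the same ball.\<close>
    define \<eta> where "\<eta> = min \<delta> (\<rho> i - ?d)"
    have "\<eta> > 0" using \<delta> iw by (simp add: \<eta>_def covers_def)
    moreover have "y \<in> off c I \<and> lab y = lab z" if "\<bar>emb y - emb z\<bar> < \<eta>" for y
    proof -
      have "\<bar>\<bar>emb y - emb w\<bar> - ?d\<bar> < \<delta>" and yw: "\<bar>emb y - emb w\<bar> < \<rho> i"
        using that unfolding \<eta>_def by linarith+
      then have fl: "\<bar>emb y - emb w\<bar> > 0" "\<lfloor>\<rho> i / \<bar>emb y - emb w\<bar>\<rfloor> = \<lfloor>\<rho> i / ?d\<rfloor>"
        using \<delta>(2) by blast+
      have yw: "covers y i w" using iw yw by (simp add: covers_def)
      have "y \<noteq> w" using fl(1) by auto
      then show ?thesis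
        using lab_covered[OF yw] lab_covered[OF iw] covered_off[OF yw] fl(2) by simp
    qed
    ultimately show ?thesis by blast
  next
    case False
    obtain \<delta> where \<delta>: "\<delta> > 0"
      "\<And>i w. i \<in> I \<Longrightarrow> w \<in> feet (c i) \<Longrightarrow> w \<noteq> z \<Longrightarrow> \<delta> \<le> \<bar>emb w - emb z\<bar>"
      using theta_discrete_isolated[OF D, of z] by blast
    \<comment> \<open>Every centre other than \<open>z\<close> is at distance at least \<delta> from
      \<open>z\<close>, so balls of radius below \<delta> / 2 stay more than \<delta> / 2 away. Only
      the finitely many larger ones in \<open>J\<close> need care.\<close>
    define J where "J = {i \<in> I. \<delta> / 2 \<le> \<rho> i}"
    have "(to_nat \<circ> c) ` J \<subseteq> {..nat \<lceil>2 / \<delta>\<rceil>}"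
    proof clarsimp
      fix i assume "i \<in> J"
      then have "\<delta> / 2 < 1 / (1 + real (to_nat (c i)))"
        using small[of i] unfolding J_def by auto
      then have "1 + real (to_nat (c i)) < 2 / \<delta>"
        using \<delta>(1) by (simp add: field_simps)
      then show "to_nat (c i) \<le> nat \<lceil>2 / \<delta>\<rceil>" by linarith
    qed
    moreover have "inj_on (to_nat \<circ> c) J"
      using c by (intro comp_inj_on inj_on_subset[OF c] inj_on_subset[OF inj_to_nat])
        (auto simp: J_def)
    ultimately have "finite J" using finite_imageD finite_subset by blast
    \<comment> \<open>These are the gaps between \<open>z\<close> and the large balls. They are
      nonnegative as \<open>z\<close> is uncovered, and nonzero as the radii avoid the
      field.\<close>
    define M where "M = (\<Union>i\<in>J. (\<lambda>w. \<bar>emb z - emb w\<bar> - \<rho> i) ` feet (c i))"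
    have "finite M" using \<open>finite J\<close> by (simp add: M_def)
    have "m > 0" if m: "m \<in> M" for m
    proof -
      obtain i w where iw: "i \<in> I" "w \<in> feet (c i)" "m = \<bar>emb z - emb w\<bar> - \<rho> i"
        using m by (auto simp: M_def J_def)
      have "\<not> covers z i w" using False by blast
      then have "m \<ge> 0" using iw by (simp add: covers_def)
      moreover have "m \<noteq> 0"
        using irr[of i] iw of_int_mult_emb_in_range[of 1 "z - w"]
        by (auto simp flip: emb_diff simp del: abs_eq_iff)
      ultimately show ?thesis by simp
    qed
    define \<eta> where "\<eta> = Min (insert (\<delta> / 2) M)"
    have "\<eta> > 0" using \<delta> \<open>finite M\<close> \<open>\<And>m. m \<in> M \<Longrightarrow> m > 0\<close> by (simp add: \<eta>_def)
    moreover have "y \<in> off c I \<and> lab y = lab z" if y: "\<bar>emb y - emb z\<bar> < \<eta>" for y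
    proof -
      have free: "\<not> covers y i w" for i w
      proof
        assume iw: "covers y i w"
        show False
        proof (cases "i \<in> J")
          case True
          then have "\<bar>emb z - emb w\<bar> - \<rho> i \<in> M" using iw by (auto simp: M_def covers_def)
          then have "\<eta> \<le> \<bar>emb z - emb w\<bar> - \<rho> i"
            unfolding \<eta>_def using \<open>finite M\<close> by (intro Min_le) auto
          then show False using y iw unfolding covers_def by linarith
        next
          case False
          have "\<eta> \<le> \<delta> / 2"
            unfolding \<eta>_def using \<open>finite M\<close> by (intro Min_le) auto
          moreover have "w \<noteq> z" using iw z by (auto simp: covers_def off_def)
          then have "\<delta> \<le> \<bar>emb w - emb z\<bar>"
            using \<delta>(2) iw unfolding covers_def by blast
          moreover have "\<rho> i < \<delta> / 2" using False iw by (simp add: J_def covers_def)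
          ultimately show False using y iw unfolding covers_def by linarith
        qed
      qed
      moreover have "\<not> covers z i w" for i w using False by blast
      ultimately have "lab y = lab z" using lab_free[of y] lab_free[of z] by simp
      moreover have "y \<in> off c I"
        using free[of _ y] pos by (auto simp: off_def covers_def)
      ultimately show ?thesis by blast
    qed
    ultimately show ?thesis by blast
  qed
  then have "loc_const (off c I) lab" by (simp add: loc_const_def)
  moreover have "lab ` off c I = I \<times> {1..}"
  proof (intro equalityI subsetI)
    fix l assume "l \<in> lab ` off c I"
    then obtain z where z: "z \<in> off c I" "l = lab z" by blast
    show "l \<in> I \<times> {1..}"
    proof (cases "\<exists>i w. covers z i w")
      case True
      then obtain i w where iw: "covers z i w" by blast
      have "1 \<le> \<rho> i / \<bar>emb z - emb w\<bar>"
        using iw covered_ne[OF iw z(1)] by (simp add: covers_def field_simps)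
      then have "1 \<le> nat \<lfloor>\<rho> i / \<bar>emb z - emb w\<bar>\<rfloor>" by linarith
      then show ?thesis using lab_covered[OF iw] z iw by (simp add: covers_def)
    next
      case False
      then show ?thesis using lab_free[of z] z i0 by auto
    qed
  next
    fix l assume "l \<in> I \<times> {1::nat..}"
    then obtain i n where l: "l = (i, n)" "i \<in> I" "n \<ge> 1" by auto
    let ?a = "emb (c i)"
    \<comment> \<open>To realise the label (i, n), choose a field element to the right of
      \<open>c i\<close> in the n-th shell; n \<ge> 1 keeps this shell inside the ball.\<close>
    have "\<rho> i / (real n + 1) < \<rho> i / real n"
      using l pos[of i] by (intro divide_strict_left_mono) auto
    then obtain z where z: "?a + \<rho> i / (real n + 1) < emb z" "emb z < ?a + \<rho> i / real n"
      using emb_dense[of "?a + \<rho> i / (real n + 1)" "?a + \<rho> i / real n"] by auto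
    define d where "d = emb z - ?a"
    have "0 < \<rho> i / (real n + 1)" using l pos[of i] by simp
    with z have d: "d > 0" "\<rho> i / (real n + 1) < d" "d < \<rho> i / real n" by (auto simp: d_def)
    then have "real n < \<rho> i / d" "\<rho> i / d < real n + 1" using l by (simp_all add: field_simps)
    then have "nat \<lfloor>\<rho> i / d\<rfloor> = n" by linarith
    moreover have "\<rho> i / real n \<le> \<rho> i" using l pos[of i] by (simp add: field_simps)
    then have iw: "covers z i (c i)" using d l by (simp add: covers_def flip: d_def)
    moreover have "z \<in> off c I" using covered_off[OF iw] d by (auto simp: d_def)
    ultimately have "lab z = l" using lab_covered[OF iw] d l by (simp flip: d_def)
    then show "l \<in> lab ` off c I" using \<open>z \<in> off c I\<close> by blast
  qed
  moreover have "\<exists>\<epsilon>>0. \<forall>w\<in>feet (c i). \<forall>z. \<bar>emb z - emb w\<bar> < \<epsilon> \<longrightarrow>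
        z = w \<or> z \<in> off c I \<and> fst (lab z) = i \<and> N \<le> snd (lab z)" if i: "i \<in> I" for i N
  \<comment> \<open>A distance below \<rho> i / (N + 1) makes the quotient exceed N + 1, so its
    floor is at least N.\<close>
  proof (intro exI[of _ "\<rho> i / (real N + 1)"] conjI ballI allI impI)
    show "0 < \<rho> i / (real N + 1)" using pos[OF i] by simp
    fix w z assume w: "w \<in> feet (c i)" and z: "\<bar>emb z - emb w\<bar> < \<rho> i / (real N + 1)"
    have "\<rho> i / (real N + 1) \<le> \<rho> i" using pos[OF i] by (simp add: field_simps)
    with w z i have iw: "covers z i w" by (simp add: covers_def)
    show "z = w \<or> z \<in> off c I \<and> fst (lab z) = i \<and> N \<le> snd (lab z)"
    proof (cases "z = w")
      case False
      then have "real N + 1 < \<rho> i / \<bar>emb z - emb w\<bar>" using z by (simp add: field_simps)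
      then have "N \<le> nat \<lfloor>\<rho> i / \<bar>emb z - emb w\<bar>\<rfloor>" by linarith
      then show ?thesis using lab_covered[OF iw] covered_off[OF iw False] by simp
    qed simp
  qed
  moreover have "\<exists>N. \<forall>z\<in>off c I. fst (lab z) = i \<and> N \<le> snd (lab z) \<longrightarrow>
        (\<exists>w\<in>feet (c i). \<bar>emb z - emb w\<bar> < \<epsilon>)" if i: "i \<in> I" "\<epsilon> > 0" for i \<epsilon>
  proof -
    obtain m where m: "\<rho> i / \<epsilon> < real m" using reals_Archimedean2 by blast
    \<comment> \<open>A second component of at least 2 excludes the default label (i0, 1), so
      \<open>z\<close> is covered; it also makes the quotient exceed m, and thus \<rho> i /
      \<epsilon>.\<close>
    have "\<exists>w\<in>feet (c i). \<bar>emb z - emb w\<bar> < \<epsilon>"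
      if z: "z \<in> off c I" "fst (lab z) = i" "m + 2 \<le> snd (lab z)" for z
    proof -
      have "\<exists>j w. covers z j w" using lab_free[of z] z by force
      then obtain j w where jw: "covers z j w" by blast
      have "j = i" using lab_covered[OF jw] z(2) by simp
      with jw have iw: "covers z i w" by simp
      let ?d = "\<bar>emb z - emb w\<bar>"
      have d: "?d > 0" using covered_ne[OF iw z(1)] by simp
      have "m + 2 \<le> nat \<lfloor>\<rho> i / ?d\<rfloor>" using lab_covered[OF iw] z by simp
      then have "real m < \<rho> i / ?d" by linarith
      then have "\<rho> i / \<epsilon> < \<rho> i / ?d" using m by linarith
      then have "?d < \<epsilon>"
        using pos[OF i(1)] d i(2) by (simp add: field_simps)
      then show ?thesis using iw by (auto simp: covers_def)
    qed
    then show ?thesis by blast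
  qed
  ultimately show ?thesis unfolding labelling_def by blast
qed

section \<open>Back and forth\<close>

text \<open>Order is compared only inside a label class. Since \<open>emb\<close> is injective, the
  equivalence also forces the relation to be the graph of an injective partial map.\<close>

definition compatible ::
    "(rat \<times> rat \<Rightarrow> 'l) \<Rightarrow> (rat \<times> rat \<Rightarrow> 'l) \<Rightarrow> ((rat \<times> rat) \<times> (rat \<times> rat)) set \<Rightarrow> bool" where
  "compatible lab lab' R \<longleftrightarrow> (\<forall>x y. (x, y) \<in> R \<longrightarrow> lab x = lab' y) \<and>
     (\<forall>x y u v. (x, y) \<in> R \<and> (u, v) \<in> R \<and> lab x = lab u \<longrightarrow> (emb x < emb u \<longleftrightarrow> emb y < emb v))"

definition fits ::
    "(rat \<times> rat \<Rightarrow> 'l) \<Rightarrow> (rat \<times> rat \<Rightarrow> 'l) \<Rightarrow> ((rat \<times> rat) \<times> (rat \<times> rat)) set \<Rightarrow>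
      rat \<times> rat \<Rightarrow> rat \<times> rat \<Rightarrow> bool" where
  "fits lab lab' R x y \<longleftrightarrow> lab x = lab' y \<and>
     (\<forall>u v. (u, v) \<in> R \<and> lab u = lab x \<longrightarrow>
        (emb x < emb u \<longleftrightarrow> emb y < emb v) \<and> (emb u < emb x \<longleftrightarrow> emb v < emb y))"

text \<open>Closure under \<open>mirror\<close> is what lets the final bijection pass to conjugacy
  classes, that is, to points of \<open>bing_set\<close>.\<close>

definition partial_iso ::
    "(rat \<times> rat) set \<Rightarrow> (rat \<times> rat) set \<Rightarrow> (rat \<times> rat \<Rightarrow> 'l) \<Rightarrow> (rat \<times> rat \<Rightarrow> 'l) \<Rightarrow>
      ((rat \<times> rat) \<times> (rat \<times> rat)) set \<Rightarrow> bool" where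
  "partial_iso S T lab lab' R \<longleftrightarrow> finite R \<and> R \<subseteq> S \<times> T \<and> compatible lab lab' R \<and>
     (\<forall>x y. (x, y) \<in> R \<longrightarrow> (mirror x, mirror y) \<in> R)"

definition matching ::
    "(rat \<times> rat) set \<Rightarrow> (rat \<times> rat) set \<Rightarrow> (rat \<times> rat \<Rightarrow> 'l) \<Rightarrow> (rat \<times> rat \<Rightarrow> 'l) \<Rightarrow>
      (rat \<times> rat \<Rightarrow> rat \<times> rat) \<Rightarrow> bool" where
  "matching S T lab lab' h \<longleftrightarrow> bij_betw h S T \<and>
     (\<forall>x\<in>S. lab' (h x) = lab x \<and> h (mirror x) = mirror (h x)) \<and>
     (\<forall>x\<in>S. \<forall>y\<in>S. lab x = lab y \<longrightarrow> (emb x < emb y \<longleftrightarrow> emb (h x) < emb (h y)))"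

section \<open>Extending finite partial isomorphisms\<close>

lemma fitsD:
  assumes "fits lab lab' R x y" "(u, v) \<in> R" "lab u = lab x"
  shows "(emb x < emb u \<longleftrightarrow> emb y < emb v) \<and> (emb u < emb x \<longleftrightarrow> emb v < emb y)"
  using assms unfolding fits_def by blast

lemma compatible_insert:
  "compatible lab lab' (insert (x, y) R) \<longleftrightarrow> compatible lab lab' R \<and> fits lab lab' R x y"
proof (intro iffI conjI)
  assume L: "compatible lab lab' (insert (x, y) R)"
  show "compatible lab lab' R" using L unfolding compatible_def by blast
  show "fits lab lab' R x y" using L unfolding compatible_def fits_def
    by (metis insert_iff)
next
  assume "compatible lab lab' R \<and> fits lab lab' R x y"
  then have c1: "\<And>x y. (x, y) \<in> R \<Longrightarrow> lab x = lab' y"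
    and c2: "\<And>x y u v. (x, y) \<in> R \<Longrightarrow> (u, v) \<in> R \<Longrightarrow> lab x = lab u \<Longrightarrow>
        emb x < emb u \<longleftrightarrow> emb y < emb v"
    and f1: "lab x = lab' y"
    and f2: "\<And>u v. (u, v) \<in> R \<Longrightarrow> lab u = lab x \<Longrightarrow>
        (emb x < emb u \<longleftrightarrow> emb y < emb v) \<and> (emb u < emb x \<longleftrightarrow> emb v < emb y)"
    unfolding compatible_def fits_def by blast+
  show "compatible lab lab' (insert (x, y) R)"
    unfolding compatible_def
  proof (intro conjI allI impI)
    fix a b assume "(a, b) \<in> insert (x, y) R"
    then show "lab a = lab' b" using c1[of a b] f1 by auto
  next
    fix a b u v assume "(a, b) \<in> insert (x, y) R \<and> (u, v) \<in> insert (x, y) R \<and> lab a = lab u"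
    then consider "(a, b) \<in> R" "(u, v) \<in> R" "lab a = lab u" | "a = x" "b = y" "u = x" "v = y"
      | "a = x" "b = y" "(u, v) \<in> R" "lab u = lab x" | "(a, b) \<in> R" "u = x" "v = y" "lab a = lab x"
      by auto
    then show "emb a < emb u \<longleftrightarrow> emb b < emb v"
      using c2[of a b u v] f2[of u v] f2[of a b] by cases auto
  qed
qed

lemma compatible_converse:
  "compatible lab lab' R \<Longrightarrow> compatible lab' lab (R\<inverse>)"
  unfolding compatible_def by (simp; metis)

lemma partial_iso_converse:
  "partial_iso S T lab lab' R \<Longrightarrow> partial_iso T S lab' lab (R\<inverse>)"
  using compatible_converse[of lab lab' R] unfolding partial_iso_def by auto

text \<open>Just above the maximum of \<open>L\<close> there is room, as \<open>P\<close> holds near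
  it and \<open>G\<close> lies strictly higher. If \<open>L\<close> is empty, the place is just
  below the minimum of \<open>G\<close>; if both are empty, anywhere that \<open>P\<close>
  holds.\<close>

lemma real_gap:
  fixes L G :: "real set"
  assumes L: "finite L" and G: "finite G" and LG: "\<And>l g. l \<in> L \<Longrightarrow> g \<in> G \<Longrightarrow> l < g"
    and P: "\<And>l. l \<in> L \<union> G \<Longrightarrow> \<exists>\<epsilon>>0. \<forall>t. \<bar>t - l\<bar> < \<epsilon> \<longrightarrow> P t"
    and Q: "\<exists>l. \<exists>\<epsilon>>0. \<forall>t. \<bar>t - l\<bar> < \<epsilon> \<longrightarrow> P t"
  shows "\<exists>s t. s < t \<and> (\<forall>x. s < x \<and> x < t \<longrightarrow> P x \<and> (\<forall>l\<in>L. l < x) \<and> (\<forall>g\<in>G. x < g))"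
proof -
  consider "L \<noteq> {}" | "L = {}" "G \<noteq> {}" | "L = {}" "G = {}" by blast
  then show ?thesis
  proof cases
    case 1
    have m: "Max L \<in> L" "\<And>l. l \<in> L \<Longrightarrow> l \<le> Max L" using L 1 by auto
    obtain \<epsilon> where \<epsilon>: "\<epsilon> > 0" "\<And>t. \<bar>t - Max L\<bar> < \<epsilon> \<Longrightarrow> P t" using P m(1) by blast
    define t where "t = Min (insert (Max L + \<epsilon>) G)"
    have "t > Max L" using G \<epsilon> LG m(1) by (simp add: t_def)
    moreover have t: "t \<le> Max L + \<epsilon>" "\<And>g. g \<in> G \<Longrightarrow> t \<le> g" using G by (auto simp: t_def)
    have "P x \<and> (\<forall>l\<in>L. l < x) \<and> (\<forall>g\<in>G. x < g)" if x: "Max L < x \<and> x < t" for x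
    proof (intro conjI ballI)
      show "P x" using x t(1) by (intro \<epsilon>(2)) auto
    qed (use x t(2) m(2) in \<open>force+\<close>)
    ultimately show ?thesis by blast
  next
    case 2
    have m: "Min G \<in> G" "\<And>g. g \<in> G \<Longrightarrow> Min G \<le> g" using G 2 by auto
    obtain \<epsilon> where \<epsilon>: "\<epsilon> > 0" "\<And>t. \<bar>t - Min G\<bar> < \<epsilon> \<Longrightarrow> P t" using P m(1) by blast
    have "P x \<and> (\<forall>l\<in>L. l < x) \<and> (\<forall>g\<in>G. x < g)" if x: "Min G - \<epsilon> < x \<and> x < Min G" for x
    proof (intro conjI ballI)
      show "P x" using x by (intro \<epsilon>(2)) auto
    qed (use x 2 m(2) in \<open>force+\<close>)
    moreover have "Min G - \<epsilon> < Min G" using \<epsilon> by simp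
    ultimately show ?thesis by blast
  next
    case 3
    obtain l \<epsilon> where \<epsilon>: "\<epsilon> > 0" "\<And>t. \<bar>t - l\<bar> < \<epsilon> \<Longrightarrow> P t" using Q by blast
    have "P x" if "l - \<epsilon> < x \<and> x < l" for x using that by (intro \<epsilon>(2)) auto
    moreover have "l - \<epsilon> < l" using \<epsilon> by simp
    ultimately show ?thesis using 3 by blast
  qed
qed

text \<open>The images of the points below and above \<open>x\<close> with the same label lie in an
  open label class, so \<open>real_gap\<close> finds an interval of admissible images. A whole ball
  is produced, not one image, because the conjugate of the image must be steered as well.\<close>

lemma one_point_extension:
  assumes R: "finite R" "R \<subseteq> S \<times> T" "compatible lab lab' R"
    and T: "loc_const T lab'" and x: "x \<notin> Domain R" "lab x \<in> lab' ` T"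
  shows "\<exists>y0. \<exists>\<delta>>0. \<forall>y. \<bar>emb y - emb y0\<bar> < \<delta> \<longrightarrow> y \<in> T \<and> fits lab lab' R x y"
proof -
  define L where "L = {v. \<exists>u. (u, v) \<in> R \<and> lab u = lab x \<and> emb u < emb x}"
  define G where "G = {v. \<exists>u. (u, v) \<in> R \<and> lab u = lab x \<and> emb x < emb u}"
  \<comment> \<open>For a real outside the field this is vacuously true, so an interval of reals can
    be discussed without leaving the field.\<close>
  define P where "P t \<longleftrightarrow> (\<forall>y. emb y = t \<longrightarrow> y \<in> T \<and> lab' y = lab x)" for t
  have lab: "lab u = lab' v" if "(u, v) \<in> R" for u v
    using R(3) that unfolding compatible_def by blast
  have order: "emb u < emb u' \<longleftrightarrow> emb v < emb v'"
    if "(u, v) \<in> R" "(u', v') \<in> R" "lab u = lab u'" for u v u' v'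
    using R(3) that unfolding compatible_def by blast
  have "L \<subseteq> snd ` R" "G \<subseteq> snd ` R" by (force simp: L_def G_def)+
  then have "finite L" "finite G" using R(1) finite_surj by blast+
  have loc: "\<exists>\<epsilon>>0. \<forall>t. \<bar>t - emb v\<bar> < \<epsilon> \<longrightarrow> P t" if "v \<in> T" "lab' v = lab x" for v
    using T that unfolding loc_const_def P_def by metis
  have LG: "emb v < emb w" if v: "v \<in> L" and w: "w \<in> G" for v w
  proof -
    obtain a b where "(a, v) \<in> R" "(b, w) \<in> R" "lab a = lab x" "lab b = lab x"
      "emb a < emb x" "emb x < emb b"
      using v w by (auto simp: L_def G_def)
    then show ?thesis using order[of a v b w] by simp
  qed
  have "\<exists>s t. s < t \<and> (\<forall>r. s < r \<and> r < t \<longrightarrow>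
      P r \<and> (\<forall>l\<in>emb ` L. l < r) \<and> (\<forall>g\<in>emb ` G. r < g))"
  proof (rule real_gap)
    fix l g assume "l \<in> emb ` L" "g \<in> emb ` G"
    then show "l < g" using LG by blast
  next
    fix l assume "l \<in> emb ` L \<union> emb ` G"
    then obtain u v where "l = emb v" and uv: "(u, v) \<in> R" "lab u = lab x"
      by (auto simp: L_def G_def)
    moreover have "v \<in> T" "lab' v = lab x"
      using R(2) uv lab[OF uv(1)] by auto
    ultimately show "\<exists>\<epsilon>>0. \<forall>t. \<bar>t - l\<bar> < \<epsilon> \<longrightarrow> P t" using loc by blast
  next
    obtain v where "v \<in> T" "lab' v = lab x" using x(2) by auto
    then show "\<exists>l. \<exists>\<epsilon>>0. \<forall>t. \<bar>t - l\<bar> < \<epsilon> \<longrightarrow> P t" using loc by blast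
  qed (use \<open>finite L\<close> \<open>finite G\<close> in auto)
  then obtain s t where st: "s < t" "\<forall>r. s < r \<and> r < t \<longrightarrow>
      P r \<and> (\<forall>l\<in>emb ` L. l < r) \<and> (\<forall>g\<in>emb ` G. r < g)"
    by (elim exE conjE)
  obtain y0 where y0: "s < emb y0" "emb y0 < t" using emb_dense[OF st(1)] by blast
  define \<delta> where "\<delta> = min (emb y0 - s) (t - emb y0)"
  have "\<delta> > 0" using y0 by (simp add: \<delta>_def)
  moreover have "y \<in> T \<and> fits lab lab' R x y" if y: "\<bar>emb y - emb y0\<bar> < \<delta>" for y
  proof -
    have bounds: "s < emb y \<and> emb y < t"
      using y unfolding \<delta>_def abs_less_iff by simp
    have *: "P (emb y)" "\<And>l. l \<in> L \<Longrightarrow> emb l < emb y" "\<And>g. g \<in> G \<Longrightarrow> emb y < emb g"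
      using st(2)[rule_format, OF bounds] by auto
    have "(emb x < emb u \<longleftrightarrow> emb y < emb v) \<and> (emb u < emb x \<longleftrightarrow> emb v < emb y)"
      if uv: "(u, v) \<in> R" "lab u = lab x" for u v
    proof -
      have "u \<noteq> x" using uv x(1) by blast
      then have "emb u < emb x \<or> emb x < emb u" by (metis emb_eq_iff linorder_neqE)
      then show ?thesis
      proof
        assume ux: "emb u < emb x"
        then have "emb v < emb y" using *(2)[of v] uv unfolding L_def by blast
        with ux show ?thesis by simp
      next
        assume ux: "emb x < emb u"
        then have "emb y < emb v" using *(3)[of v] uv unfolding G_def by blast
        with ux show ?thesis by simp
      qed
    qed
    then show ?thesis using *(1) by (auto simp: fits_def P_def)
  qed
  ultimately show ?thesis by blast
qed

lemma order_stable:
  fixes a b s t :: real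
  assumes "\<bar>s - a\<bar> < \<bar>a - b\<bar> / 2" "\<bar>t - b\<bar> < \<bar>a - b\<bar> / 2"
  shows "a < b \<longleftrightarrow> s < t"
proof (cases "a < b")
  case True
  then have eq: "\<bar>a - b\<bar> = b - a" by simp
  have "s < t" using assms[unfolded eq abs_less_iff] by auto
  with True show ?thesis by simp
next
  case False
  then have eq: "\<bar>a - b\<bar> = a - b" by simp
  have "\<not> s < t" using assms[unfolded eq abs_less_iff] by auto
  with False show ?thesis by simp
qed

text \<open>The elements \<open>x\<close> and \<open>mirror x\<close> must enter together. Images
  \<open>y0\<close> and \<open>y1\<close> are first chosen for them as if they were independent;
  weak approximation then gives one \<open>z\<close> near \<open>y0\<close> whose conjugate is near
  \<open>y1\<close>.\<close>

lemma partial_iso_extend: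
  assumes R: "partial_iso S T lab lab' R" and T: "loc_const T lab'"
    and mirror: "\<And>z. z \<in> S \<Longrightarrow> mirror z \<in> S"
    and lab: "lab ` S \<subseteq> lab' ` T" and x: "x \<in> S"
  shows "\<exists>R'. R \<subseteq> R' \<and> partial_iso S T lab lab' R' \<and> x \<in> Domain R'"
proof (cases "x \<in> Domain R")
  case True
  then show ?thesis using R by blast
next
  case False
  have R': "finite R" "R \<subseteq> S \<times> T" "compatible lab lab' R"
    "\<And>x y. (x, y) \<in> R \<Longrightarrow> (mirror x, mirror y) \<in> R"
    using R by (auto simp: partial_iso_def)
  have mx: "mirror x \<notin> Domain R" using False R'(4) by (metis Domain.cases DomainI mirror_mirror)
  obtain y0 \<delta>0 where \<delta>0: "\<delta>0 > 0"
    "\<And>y. \<bar>emb y - emb y0\<bar> < \<delta>0 \<Longrightarrow> y \<in> T \<and> fits lab lab' R x y"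
    using one_point_extension[OF R'(1-3) T False] x lab by blast
  have "\<exists>y. y \<in> T \<and> mirror y \<in> T \<and>
      compatible lab lab' (insert (mirror x, mirror y) (insert (x, y) R))"
  proof (cases "mirror x = x")
    case True
    \<comment> \<open>A self-conjugate element needs a self-conjugate image, so a rational one is
      taken from the ball.\<close>
    obtain a where "\<bar>emb (a, 0) - emb y0\<bar> < \<delta>0" using rational_approx[OF \<delta>0(1)] by blast
    then have "(a, 0) \<in> T" "fits lab lab' R x (a, 0)" using \<delta>0(2) by auto
    then show ?thesis using True R'(3)
      by (intro exI[of _ "(a, 0)"]) (simp add: compatible_insert)
  next
    case ne: False
    let ?R = "insert (x, y0) R"
    have y0: "y0 \<in> T" "fits lab lab' R x y0" using \<delta>0 by auto
    have "mirror x \<notin> Domain ?R" using mx ne by auto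
    moreover have "?R \<subseteq> S \<times> T" using R' x y0 by auto
    moreover have "compatible lab lab' ?R" using R' y0 by (simp add: compatible_insert)
    moreover have "lab (mirror x) \<in> lab' ` T" using lab mirror[OF x] by blast
    ultimately obtain y1 \<delta>1 where \<delta>1: "\<delta>1 > 0"
      "\<And>y. \<bar>emb y - emb y1\<bar> < \<delta>1 \<Longrightarrow> y \<in> T \<and> fits lab lab' ?R (mirror x) y"
      using one_point_extension[of ?R S T lab lab' "mirror x"] R'(1) T by blast
    have f1: "fits lab lab' ?R (mirror x) y1" using \<delta>1 by simp
    \<comment> \<open>Equal images would give \<open>x\<close> and \<open>mirror x\<close> equal
      labels, and then the order condition would identify them.\<close>
    have "y0 \<noteq> y1"
    proof
      assume eq: "y0 = y1"
      have "lab x = lab (mirror x)" using f1 y0(2) eq by (simp add: fits_def)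
      then have "\<not> emb (mirror x) < emb x" "\<not> emb x < emb (mirror x)"
        using f1 eq unfolding fits_def by blast+
      then show False using ne by (metis emb_eq_iff linorder_neqE)
    qed
    \<comment> \<open>The bounds \<delta>0 and \<delta>1 keep both images admissible; half the
      distance keeps the mutual order of \<open>y0\<close> and \<open>y1\<close>.\<close>
    define \<eta> where "\<eta> = min (min \<delta>0 \<delta>1) (\<bar>emb y0 - emb y1\<bar> / 2)"
    have "\<eta> > 0" using \<open>y0 \<noteq> y1\<close> \<delta>0 \<delta>1 by (simp add: \<eta>_def)
    then obtain z where z: "\<bar>emb z - emb y0\<bar> < \<eta>" "\<bar>emb (mirror z) - emb y1\<bar> < \<eta>"
      using weak_approximation by blast
    have zT: "z \<in> T" "fits lab lab' R x z" using \<delta>0(2)[of z] z by (auto simp: \<eta>_def)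
    have mz: "mirror z \<in> T" "fits lab lab' ?R (mirror x) (mirror z)"
      using \<delta>1(2)[of "mirror z"] z by (auto simp: \<eta>_def)
    have ord: "emb y1 < emb y0 \<longleftrightarrow> emb (mirror z) < emb z" "emb y0 < emb y1 \<longleftrightarrow> emb z < emb (mirror z)"
      using order_stable[of "emb z" "emb y0" "emb y1" "emb (mirror z)"]
        order_stable[of "emb (mirror z)" "emb y1" "emb y0" "emb z"] z
      by (simp_all add: \<eta>_def abs_minus_commute)
    have "fits lab lab' (insert (x, z) R) (mirror x) (mirror z)"
      unfolding fits_def
    proof (intro conjI[OF _ allI[OF allI[OF impI]]])
      show "lab (mirror x) = lab' (mirror z)" using mz(2) by (simp add: fits_def)
      fix u v assume uv: "(u, v) \<in> insert (x, z) R \<and> lab u = lab (mirror x)"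
      show "(emb (mirror x) < emb u \<longleftrightarrow> emb (mirror z) < emb v) \<and>
          (emb u < emb (mirror x) \<longleftrightarrow> emb v < emb (mirror z))"
      \<comment> \<open>Admissibility of \<open>mirror z\<close> was obtained relative to
        \<open>(x, y0)\<close>; only the replacement pair \<open>(x, z)\<close> has to be compared
        through \<open>ord\<close>.\<close>
      proof (cases "(u, v) \<in> R")
        case True
        then show ?thesis using mz(2) uv unfolding fits_def by blast
      next
        case False
        then have "u = x" "v = z" "lab x = lab (mirror x)" using uv by auto
        then show ?thesis using fitsD[OF f1, of x y0] ord by simp
      qed
    qed
    then show ?thesis
      using zT mz(1) R'(3) by (intro exI[of _ z]) (simp add: compatible_insert)
  qed
  then obtain y where y: "y \<in> T" "mirror y \<in> T"
      "compatible lab lab' (insert (mirror x, mirror y) (insert (x, y) R))" by blast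
  have "partial_iso S T lab lab' (insert (mirror x, mirror y) (insert (x, y) R))"
    using R' y x mirror[OF x] by (auto simp: partial_iso_def)
  then show ?thesis by (intro exI[of _ "insert (mirror x, mirror y) (insert (x, y) R)"]) auto
qed

text \<open>The back step is the forth step applied to the converse relation.\<close>

lemma partial_iso_extend_both:
  assumes R: "partial_iso S T lab lab' R" and "loc_const S lab" "loc_const T lab'"
    and "\<And>z. z \<in> S \<Longrightarrow> mirror z \<in> S" "\<And>z. z \<in> T \<Longrightarrow> mirror z \<in> T"
    and "lab ` S = lab' ` T"
  shows "\<exists>R'. R \<subseteq> R' \<and> partial_iso S T lab lab' R' \<and>
    (x \<in> S \<longrightarrow> x \<in> Domain R') \<and> (x \<in> T \<longrightarrow> x \<in> Range R')"
proof -
  obtain R1 where R1: "R \<subseteq> R1" "partial_iso S T lab lab' R1" "x \<in> S \<longrightarrow> x \<in> Domain R1"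
    using partial_iso_extend[OF R] assms by (metis order_refl)
  obtain R2 where R2: "R1\<inverse> \<subseteq> R2" "partial_iso T S lab' lab R2" "x \<in> T \<longrightarrow> x \<in> Domain R2"
    using partial_iso_extend[OF partial_iso_converse[OF R1(2)]] partial_iso_converse[OF R1(2)] assms
    by (metis order_refl)
  have "R1 \<subseteq> R2\<inverse>" using R2(1) by auto
  moreover have "partial_iso S T lab lab' (R2\<inverse>)" by (rule partial_iso_converse[OF R2(2)])
  ultimately show ?thesis using R1 R2(3) by (intro exI[of _ "R2\<inverse>"]) blast
qed

lemma back_and_forth:
  assumes S: "loc_const S lab" and T: "loc_const T lab'"
    and mS: "\<And>z. z \<in> S \<Longrightarrow> mirror z \<in> S" and mT: "\<And>z. z \<in> T \<Longrightarrow> mirror z \<in> T"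
    and lab: "lab ` S = lab' ` T"
  shows "\<exists>h. matching S T lab lab' h"
proof -
  \<comment> \<open>This enumerates the whole field; stage n + 1 treats the n-th element on
    whichever sides contain it.\<close>
  define pt where "pt n = (from_nat n :: rat \<times> rat)" for n
  have "\<exists>f. \<forall>n. partial_iso S T lab lab' (f n) \<and> (f n \<subseteq> f (Suc n) \<and>
      (pt n \<in> S \<longrightarrow> pt n \<in> Domain (f (Suc n))) \<and> (pt n \<in> T \<longrightarrow> pt n \<in> Range (f (Suc n))))"
  proof (rule dependent_nat_choice)
    show "\<exists>R. partial_iso S T lab lab' R"
      by (intro exI[of _ "{}"]) (simp add: partial_iso_def compatible_def)
    show "\<exists>R'. partial_iso S T lab lab' R' \<and> R \<subseteq> R' \<and>
        (pt n \<in> S \<longrightarrow> pt n \<in> Domain R') \<and> (pt n \<in> T \<longrightarrow> pt n \<in> Range R')"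
      if "partial_iso S T lab lab' R" for R n
      using partial_iso_extend_both[OF that S T mS mT lab, of "pt n"] by blast
  qed
  then obtain f where f: "\<And>n. partial_iso S T lab lab' (f n)" "\<And>n. f n \<subseteq> f (Suc n)"
    "\<And>n. pt n \<in> S \<Longrightarrow> pt n \<in> Domain (f (Suc n))" "\<And>n. pt n \<in> T \<Longrightarrow> pt n \<in> Range (f (Suc n))"
    by blast
  \<comment> \<open>Any two pairs of the union lie in a common stage, so the conditions on pairs
    pass to the limit.\<close>
  define Q where "Q = (\<Union>n. f n)"
  have mono: "f m \<subseteq> f n" if "m \<le> n" for m n
    by (rule lift_Suc_mono_le[of f, OF f(2) that])
  have both: "\<exists>n. p \<in> f n \<and> q \<in> f n" if pq: "p \<in> Q" "q \<in> Q" for p q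
  proof -
    obtain m n where "p \<in> f m" "q \<in> f n" using pq by (auto simp: Q_def)
    then have "p \<in> f (max m n)" "q \<in> f (max m n)"
      using mono[of m "max m n"] mono[of n "max m n"] by auto
    then show ?thesis by blast
  qed
  have iso: "x \<in> S" "y \<in> T" "lab x = lab' y" "(mirror x, mirror y) \<in> Q" if "(x, y) \<in> Q" for x y
  proof -
    obtain n where "(x, y) \<in> f n" using \<open>(x, y) \<in> Q\<close> by (auto simp: Q_def)
    then have "x \<in> S \<and> y \<in> T \<and> lab x = lab' y \<and> (mirror x, mirror y) \<in> f n"
      using f(1)[of n] unfolding partial_iso_def compatible_def by blast
    then show "x \<in> S" "y \<in> T" "lab x = lab' y" "(mirror x, mirror y) \<in> Q"
      by (auto simp: Q_def)
  qed
  have order: "emb x < emb u \<longleftrightarrow> emb y < emb v"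
    if xy: "(x, y) \<in> Q" and uv: "(u, v) \<in> Q" and eq: "lab x = lab u" for x y u v
  proof -
    obtain n where "(x, y) \<in> f n" "(u, v) \<in> f n" using both[OF xy uv] by blast
    then show ?thesis using f(1)[of n] eq unfolding partial_iso_def compatible_def by blast
  qed
  have total: "\<exists>y. (x, y) \<in> Q" if "x \<in> S" for x
    using f(3)[of "to_nat x"] that by (auto simp: Q_def pt_def)
  have onto: "\<exists>x. (x, y) \<in> Q" if "y \<in> T" for y
    using f(4)[of "to_nat y"] that by (auto simp: Q_def pt_def)
  have single: "y = v" if xy: "(x, y) \<in> Q" and xv: "(x, v) \<in> Q" for x y v
    using order[OF xy xv] order[OF xv xy] by (metis emb_eq_iff linorder_neqE order_less_irrefl)
  have inj: "x = u" if xy: "(x, y) \<in> Q" and uy: "(u, y) \<in> Q" for x u y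
    using order[OF xy uy] order[OF uy xy] iso(3)[OF xy] iso(3)[OF uy]
    by (metis emb_eq_iff linorder_neqE order_less_irrefl)
  obtain h where h: "\<And>x. x \<in> S \<Longrightarrow> (x, h x) \<in> Q" using total by metis
  have "bij_betw h S T"
    unfolding bij_betw_def
  proof
    show "inj_on h S"
    proof (rule inj_onI)
      fix x u assume "x \<in> S" "u \<in> S" "h x = h u"
      then show "x = u" using h[of x] h[of u] inj[of x "h x" u] by simp
    qed
    show "h ` S = T"
    proof
      show "h ` S \<subseteq> T" using iso(2)[OF h] by blast
      show "T \<subseteq> h ` S"
      proof
        fix y assume "y \<in> T"
        then obtain x where xy: "(x, y) \<in> Q" using onto by blast
        then have "y = h x" using single[OF xy h] iso(1) by blast
        then show "y \<in> h ` S" using iso(1)[OF xy] by blast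
      qed
    qed
  qed
  moreover have "h (mirror x) = mirror (h x)" if "x \<in> S" for x
    using single[OF h[OF mS[OF that]]] iso(4)[OF h[OF that]] by blast
  moreover have "lab' (h x) = lab x" if "x \<in> S" for x
    using iso(3)[OF h[OF that]] by simp
  moreover have "emb x < emb y \<longleftrightarrow> emb (h x) < emb (h y)" if "x \<in> S" "y \<in> S" "lab x = lab y" for x y
    using order[OF h[OF that(1)] h[OF that(2)] that(3)] .
  ultimately show ?thesis unfolding matching_def by blast
qed

section \<open>Homeomorphisms from matchings\<close>

lemma matchingD:
  assumes "matching S T lab lab' h"
  shows "bij_betw h S T" "\<And>x. x \<in> S \<Longrightarrow> lab' (h x) = lab x"
    "\<And>x. x \<in> S \<Longrightarrow> h (mirror x) = mirror (h x)"
    "\<And>x y. x \<in> S \<Longrightarrow> y \<in> S \<Longrightarrow> lab x = lab y \<Longrightarrow> emb x < emb y \<longleftrightarrow> emb (h x) < emb (h y)"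
    "\<And>x. x \<in> S \<Longrightarrow> h x \<in> T"
  using assms unfolding matching_def by (blast dest: bij_betwE)+

lemma matching_inverse:
  assumes m: "matching S T lab lab' h" and mS: "\<And>z. z \<in> S \<Longrightarrow> mirror z \<in> S"
  shows "matching T S lab' lab (inv_into S h)"
proof -
  note h = matchingD[OF m]
  let ?k = "inv_into S h"
  have bij: "bij_betw ?k T S" using h(1) by (rule bij_betw_inv_into)
  have k: "?k y \<in> S" "h (?k y) = y" if "y \<in> T" for y
    using that h(1) bij by (auto dest: bij_betwE simp: bij_betw_inv_into_right)
  have kh: "?k (h x) = x" if "x \<in> S" for x
    using that h(1) by (rule bij_betw_inv_into_left[rotated])
  have "lab (?k y) = lab' y" if "y \<in> T" for y
    using h(2)[OF k(1)[OF that]] k(2)[OF that] by simp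
  moreover have "?k (mirror y) = mirror (?k y)" if "y \<in> T" for y
    using kh[OF mS[OF k(1)[OF that]]] h(3)[OF k(1)[OF that]] k(2)[OF that] by simp
  moreover have "emb x < emb y \<longleftrightarrow> emb (?k x) < emb (?k y)"
    if "x \<in> T" "y \<in> T" "lab' x = lab' y" for x y
    using h(4)[OF k(1)[OF that(1)] k(1)[OF that(2)]] k(2)[OF that(1)] k(2)[OF that(2)]
      h(2)[OF k(1)[OF that(1)]] h(2)[OF k(1)[OF that(2)]] that(3) by simp
  ultimately show ?thesis using bij by (simp add: matching_def)
qed

text \<open>Take \<open>y1\<close> and \<open>y2\<close> on either side of \<open>h x\<close>, close
  to it and in its label class. Their preimages enclose \<open>x\<close> and carry its label, so by
  monotonicity the elements of this class between them are mapped between \<open>y1\<close> and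
  \<open>y2\<close>.\<close>

lemma matching_continuous:
  assumes m: "matching S T lab lab' h" and S: "loc_const S lab" and T: "loc_const T lab'"
    and x: "x \<in> S" and \<epsilon>: "\<epsilon> > 0"
  shows "\<exists>\<delta>>0. \<forall>z. \<bar>emb z - emb x\<bar> < \<delta> \<longrightarrow> z \<in> S \<and> \<bar>emb (h z) - emb (h x)\<bar> < \<epsilon>"
proof -
  note h = matchingD[OF m]
  obtain \<eta> where \<eta>: "\<eta> > 0"
    "\<And>y. \<bar>emb y - emb (h x)\<bar> < \<eta> \<Longrightarrow> y \<in> T \<and> lab' y = lab' (h x)"
    using T h(5)[OF x] unfolding loc_const_def by blast
  obtain \<theta> where \<theta>: "\<theta> > 0" "\<And>y. \<bar>emb y - emb x\<bar> < \<theta> \<Longrightarrow> y \<in> S \<and> lab y = lab x"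
    using S x unfolding loc_const_def by blast
  define \<gamma> where "\<gamma> = min \<epsilon> \<eta>"
  have "\<gamma> > 0" using \<epsilon> \<eta> by (simp add: \<gamma>_def)
  obtain y1 where y1: "emb (h x) - \<gamma> < emb y1" "emb y1 < emb (h x)"
    using emb_dense[of "emb (h x) - \<gamma>" "emb (h x)"] \<open>\<gamma> > 0\<close> by auto
  obtain y2 where y2: "emb (h x) < emb y2" "emb y2 < emb (h x) + \<gamma>"
    using emb_dense[of "emb (h x)" "emb (h x) + \<gamma>"] \<open>\<gamma> > 0\<close> by auto
  have pre: "\<exists>a\<in>S. h a = y \<and> lab a = lab x" if "\<bar>emb y - emb (h x)\<bar> < \<gamma>" for y
  proof -
    have y: "y \<in> T" "lab' y = lab' (h x)" using \<eta>(2)[of y] that by (auto simp: \<gamma>_def)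
    then obtain a where a: "a \<in> S" "h a = y" using h(1) by (auto simp: bij_betw_def)
    then show ?thesis using h(2)[OF a(1)] h(2)[OF x] y by auto
  qed
  have "\<bar>emb y1 - emb (h x)\<bar> < \<gamma>" "\<bar>emb y2 - emb (h x)\<bar> < \<gamma>"
    using y1 y2 by (auto simp: abs_less_iff)
  then obtain a b where a: "a \<in> S" "h a = y1" "lab a = lab x" and b: "b \<in> S" "h b = y2" "lab b = lab x"
    using pre by blast
  have ab: "emb a < emb x" "emb x < emb b"
    using h(4)[OF a(1) x a(3)] h(4)[OF x b(1) b(3)[symmetric]] a b y1 y2 by auto
  define \<delta> where "\<delta> = min \<theta> (min (emb x - emb a) (emb b - emb x))"
  have "\<delta> > 0" using \<theta> ab by (simp add: \<delta>_def)
  moreover have "z \<in> S \<and> \<bar>emb (h z) - emb (h x)\<bar> < \<epsilon>" if z: "\<bar>emb z - emb x\<bar> < \<delta>" for z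
  proof -
    have zS: "z \<in> S" "lab z = lab x" using \<theta>(2)[of z] z by (auto simp: \<delta>_def)
    have "emb a < emb z" "emb z < emb b" using z by (auto simp: \<delta>_def abs_less_iff)
    then have "emb y1 < emb (h z)" "emb (h z) < emb y2"
      using h(4)[OF a(1) zS(1)] h(4)[OF zS(1) b(1)] zS(2) a b by auto
    then have "\<bar>emb (h z) - emb (h x)\<bar> < \<epsilon>"
      using y1 y2 by (auto simp: \<gamma>_def abs_less_iff)
    then show ?thesis using zS by blast
  qed
  ultimately show ?thesis by blast
qed

section \<open>Gluing along the removed classes\<close>

lemma off_upper_iff [simp]: "upper z \<in> off c I \<longleftrightarrow> z \<in> off c I"
  using upper_cases[of z] by (metis mirror_in_off)

lemma bing_set_off_cases:
  assumes "p \<in> bing_set" "c ` I \<subseteq> bing_set"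
  shows "p \<in> off c I \<or> (\<exists>i\<in>I. p = c i)"
proof (cases "p \<in> off c I")
  case False
  then obtain i where i: "i \<in> I" "p \<in> feet (c i)" by (auto simp: off_def)
  moreover have "c i \<in> bing_set" using i(1) assms(2) by blast
  ultimately have "p = c i" using assms(1) feet_inject feet_eq by metis
  then show ?thesis using i(1) by blast
qed simp

text \<open>Away from the removed classes, continuity of \<open>h\<close> at both feet suffices. At
  \<open>c i\<close>, closeness means labels (i, n) with large n at all feet; \<open>h\<close> keeps
  the labels, and on the other side such labels mean closeness to \<open>c' i\<close>.\<close>

lemma labelling_glue_continuous:
  assumes lab: "labelling c I lab" and lab': "labelling c' I lab'"
    and m: "matching (off c I) (off c' I) lab lab' h"
    and c: "\<And>i. i \<in> I \<Longrightarrow> c i \<in> bing_set" and c': "\<And>i. i \<in> I \<Longrightarrow> c' i \<in> bing_set"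
    and gc: "\<And>i. i \<in> I \<Longrightarrow> g (c i) = c' i"
    and gh: "\<And>p. p \<in> off c I \<Longrightarrow> g p = upper (h p)"
  shows "continuous_map ritter_space ritter_space g"
proof (rule continuous_map_ritterI)
  note h = matchingD[OF m]
  have cB: "c ` I \<subseteq> bing_set" using c by blast
  show "g \<in> bing_set \<rightarrow> bing_set"
  proof
    fix p assume "p \<in> bing_set"
    then have "p \<in> off c I \<or> (\<exists>i\<in>I. p = c i)" using cB by (rule bing_set_off_cases)
    then show "g p \<in> bing_set" by (auto simp: gc gh c')
  qed
  fix p and \<epsilon> :: real assume p: "p \<in> bing_set" and \<epsilon>: "\<epsilon> > 0"
  \<comment> \<open>As \<open>h\<close> commutes with conjugation, it maps the feet of
    \<open>q\<close> onto those of its image.\<close>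
  have feet_h: "\<exists>u\<in>feet q. z = h u" if "q \<in> off c I" "z \<in> feet (upper (h q))" for q z
    using that h(3)[OF that(1)] by (auto simp: feet_def[of q] feet_def[of "h q"])
  have feet_off: "u \<in> off c I" if "q \<in> off c I" "u \<in> feet q" for q u
    using that by (auto simp: feet_def)
  consider "p \<in> off c I" | i where "i \<in> I" "p = c i"
    using bing_set_off_cases[OF p cB] by blast
  then show "\<exists>\<delta>>0. g ` nbhd \<delta> p \<subseteq> nbhd \<epsilon> (g p)"
  proof cases
    case 1
    have "mirror p \<in> off c I" using 1 by simp
    have cont: "\<exists>\<delta>>0. \<forall>z. \<bar>emb z - emb x\<bar> < \<delta> \<longrightarrow> z \<in> off c I \<and> \<bar>emb (h z) - emb (h x)\<bar> < \<epsilon>"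
      if "x \<in> off c I" for x
      using matching_continuous[OF m _ _ that \<epsilon>] lab lab' by (simp add: labelling_def)
    obtain \<delta>1 where \<delta>1: "\<delta>1 > 0" "\<forall>z. \<bar>emb z - emb p\<bar> < \<delta>1 \<longrightarrow>
        z \<in> off c I \<and> \<bar>emb (h z) - emb (h p)\<bar> < \<epsilon>"
      using cont[OF 1] by (elim exE conjE)
    obtain \<delta>2 where \<delta>2: "\<delta>2 > 0" "\<forall>z. \<bar>emb z - emb (mirror p)\<bar> < \<delta>2 \<longrightarrow>
        z \<in> off c I \<and> \<bar>emb (h z) - emb (h (mirror p))\<bar> < \<epsilon>"
      using cont[OF \<open>mirror p \<in> off c I\<close>] by (elim exE conjE)
    have near: "u \<in> off c I \<and> (\<exists>v\<in>feet (h p). \<bar>emb (h u) - emb v\<bar> < \<epsilon>)"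
      if u: "w \<in> feet p" "\<bar>emb u - emb w\<bar> < min \<delta>1 \<delta>2" for u w
    proof -
      consider "w = p" | "w = mirror p" using u(1) by (auto simp: feet_def)
      then show ?thesis
      proof cases
        case 1
        then have "u \<in> off c I" "\<bar>emb (h u) - emb (h p)\<bar> < \<epsilon>"
          using \<delta>1(2)[rule_format, of u] u(2) by auto
        then show ?thesis using self_in_feet by blast
      next
        case 2
        then have "u \<in> off c I" "\<bar>emb (h u) - emb (mirror (h p))\<bar> < \<epsilon>"
          using \<delta>2(2)[rule_format, of u] u(2) h(3)[OF \<open>p \<in> off c I\<close>] by auto
        moreover have "mirror (h p) \<in> feet (h p)" by simp
        ultimately show ?thesis by blast
      qed
    qed
    have "g q \<in> nbhd \<epsilon> (g p)" if q: "q \<in> nbhd (min \<delta>1 \<delta>2) p" for q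
    proof -
      have uw: "\<exists>w\<in>feet p. \<bar>emb u - emb w\<bar> < min \<delta>1 \<delta>2" if "u \<in> feet q" for u
        using q that unfolding nbhd_def by blast
      have qo: "q \<in> off c I" using uw[OF self_in_feet] near by blast
      have "\<exists>v\<in>feet (upper (h p)). \<bar>emb z - emb v\<bar> < \<epsilon>" if z: "z \<in> feet (upper (h q))" for z
      proof -
        obtain u where u: "u \<in> feet q" "z = h u" using feet_h[OF qo z] by blast
        obtain w where "w \<in> feet p" "\<bar>emb u - emb w\<bar> < min \<delta>1 \<delta>2" using uw[OF u(1)] by blast
        from near[OF this] u(2) show ?thesis by simp
      qed
      then show ?thesis by (simp add: nbhd_def gh[OF qo] gh[OF 1])
    qed
    then show ?thesis using \<delta>1 \<delta>2 by (intro exI[of _ "min \<delta>1 \<delta>2"]) auto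
  next
    case (2 i)
    obtain N where N: "\<forall>z\<in>off c' I. fst (lab' z) = i \<and> N \<le> snd (lab' z) \<longrightarrow>
        (\<exists>w\<in>feet (c' i). \<bar>emb z - emb w\<bar> < \<epsilon>)"
      using lab' 2(1) \<epsilon> unfolding labelling_def by meson
    obtain \<delta> where \<delta>: "\<delta> > 0" "\<forall>w\<in>feet (c i). \<forall>z. \<bar>emb z - emb w\<bar> < \<delta> \<longrightarrow>
        z = w \<or> z \<in> off c I \<and> fst (lab z) = i \<and> N \<le> snd (lab z)"
      using lab 2(1) unfolding labelling_def by meson
    have "g q \<in> nbhd \<epsilon> (c' i)" if q: "q \<in> nbhd \<delta> (c i)" for q
    proof -
      have uw: "\<exists>w\<in>feet (c i). \<bar>emb u - emb w\<bar> < \<delta>" if "u \<in> feet q" for u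
        using q that unfolding nbhd_def by blast
      show ?thesis
      proof (cases "q \<in> off c I")
        case True
        have "\<exists>w\<in>feet (c' i). \<bar>emb z - emb w\<bar> < \<epsilon>" if z: "z \<in> feet (upper (h q))" for z
        proof -
          obtain u where u: "u \<in> feet q" "z = h u" using feet_h[OF True z] by blast
          obtain w where w: "w \<in> feet (c i)" "\<bar>emb u - emb w\<bar> < \<delta>" using uw[OF u(1)] by blast
          have uo: "u \<in> off c I" using feet_off[OF True u(1)] .
          then have "u \<noteq> w" using w(1) 2(1) by (auto simp: off_def)
          then have "fst (lab u) = i \<and> N \<le> snd (lab u)" using \<delta>(2) w by blast
          then show ?thesis using N h(2)[OF uo] h(5)[OF uo] u(2) by simp
        qed
        then show ?thesis by (simp add: nbhd_def gh[OF True])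
      next
        case False
        \<comment> \<open>A removed point this close to a foot of \<open>c i\<close> must equal that
          foot, and so it is \<open>c i\<close> itself.\<close>
        obtain w where w: "w \<in> feet (c i)" "\<bar>emb q - emb w\<bar> < \<delta>" using uw[OF self_in_feet] by blast
        then have "q = w" using \<delta>(2) False by blast
        then have "feet q = feet (c i)" using w(1) feet_eq by blast
        moreover have "q \<in> bing_set" using q by (simp add: nbhd_def)
        ultimately have "q = c i" using feet_inject c[OF 2(1)] by blast
        then show ?thesis using gc[OF 2(1)] self_in_nbhd c'[OF 2(1)] \<epsilon> by simp
      qed
    qed
    then show ?thesis using \<delta>(1) gc[OF 2(1)] 2(2) by (intro exI[of _ \<delta>]) auto
  qed
qed

lemma theta_discrete_homeomorphism:
  assumes c: "inj_on c I" "theta_discrete_in ritter_space (c ` I)"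
    and c': "inj_on c' I" "theta_discrete_in ritter_space (c' ` I)"
    and ne: "I \<noteq> {}"
  shows "\<exists>g. homeomorphic_map ritter_space ritter_space g \<and> (\<forall>i\<in>I. g (c i) = c' i)"
proof -
  obtain i0 where i0: "i0 \<in> I" using ne by blast
  obtain lab lab' where lab: "labelling c I lab" and lab': "labelling c' I lab'"
    using labelling_exists[OF c i0] labelling_exists[OF c' i0] by blast
  have cB: "c ` I \<subseteq> bing_set" "c' ` I \<subseteq> bing_set"
    using c(2) c'(2) by (auto simp: theta_discrete_in_def)
  then have B: "c i \<in> bing_set" "c' i \<in> bing_set" if "i \<in> I" for i
    using that by auto
  have "\<exists>h. matching (off c I) (off c' I) lab lab' h"
    using lab lab' by (intro back_and_forth) (auto simp: labelling_def)
  then obtain h where h: "matching (off c I) (off c' I) lab lab' h" by blast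
  define k where "k = inv_into (off c I) h"
  have k: "matching (off c' I) (off c I) lab' lab k"
    unfolding k_def using h by (rule matching_inverse) simp
  define g where "g p = (if p \<in> off c I then upper (h p) else c' (inv_into I c p))" for p
  define f where "f p = (if p \<in> off c' I then upper (k p) else c (inv_into I c' p))" for p
  have gc: "g (c i) = c' i" and fc: "f (c' i) = c i" if "i \<in> I" for i
    using that c(1) c'(1) by (auto simp: g_def f_def off_def)
  have gh: "g p = upper (h p)" if "p \<in> off c I" for p using that by (simp add: g_def)
  have fk: "f p = upper (k p)" if "p \<in> off c' I" for p using that by (simp add: f_def)
  have kh: "k (h x) = x" if "x \<in> off c I" for x
    unfolding k_def by (rule bij_betw_inv_into_left[OF matchingD(1)[OF h] that])
  have hk: "h (k x) = x" if "x \<in> off c' I" for x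
    unfolding k_def by (rule bij_betw_inv_into_right[OF matchingD(1)[OF h] that])
  have "continuous_map ritter_space ritter_space g"
    by (rule labelling_glue_continuous[OF lab lab' h]) (use B gc gh in auto)
  moreover have "continuous_map ritter_space ritter_space f"
    by (rule labelling_glue_continuous[OF lab' lab k]) (use B fc fk in auto)
  moreover have "f (g p) = p" if "p \<in> bing_set" for p
    using bing_set_off_cases[OF that cB(1)]
  proof (elim disjE)
    assume 1: "p \<in> off c I"
    then have "upper (h p) \<in> off c' I" using matchingD(5)[OF h] by simp
    then have "f (g p) = upper (k (upper (h p)))" using 1 by (simp add: gh fk)
    also have "\<dots> = p"
      using upper_cases[of "h p"]
    proof
      assume "upper (h p) = h p"
      then show ?thesis using kh[OF 1] upper_ident[OF that] by simp
    next
      assume "upper (h p) = mirror (h p)"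
      also have "\<dots> = h (mirror p)" using matchingD(3)[OF h 1] by simp
      finally show ?thesis
        using kh[of "mirror p"] 1 upper_feet[of "mirror p" p] upper_ident[OF that] by simp
    qed
    finally show "f (g p) = p" .
  qed (auto simp: gc fc)
  moreover have "g (f p) = p" if "p \<in> bing_set" for p
    using bing_set_off_cases[OF that cB(2)]
  proof (elim disjE)
    assume 1: "p \<in> off c' I"
    then have "upper (k p) \<in> off c I" using matchingD(5)[OF k] by simp
    then have "g (f p) = upper (h (upper (k p)))" using 1 by (simp add: gh fk)
    also have "\<dots> = p"
      using upper_cases[of "k p"]
    proof
      assume "upper (k p) = k p"
      then show ?thesis using hk[OF 1] upper_ident[OF that] by simp
    next
      assume "upper (k p) = mirror (k p)"
      also have "\<dots> = k (mirror p)" using matchingD(3)[OF k 1] by simp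
      finally show ?thesis
        using hk[of "mirror p"] 1 upper_feet[of "mirror p" p] upper_ident[OF that] by simp
    qed
    finally show "g (f p) = p" .
  qed (auto simp: gc fc)
  ultimately have "homeomorphic_maps ritter_space ritter_space g f"
    by (simp add: homeomorphic_maps_def)
  then show ?thesis using gc homeomorphic_maps_map by blast
qed

theorem corollary2:
  fixes A B :: "(rat \<times> rat) set" and f :: "rat \<times> rat \<Rightarrow> rat \<times> rat"
  assumes "theta_discrete_in ritter_space A"
    and "theta_discrete_in ritter_space B"
    and "bij_betw f A B"
  shows "\<exists>g. homeomorphic_map ritter_space ritter_space g \<and> (\<forall>a\<in>A. g a = f a)"
proof (cases "A = {}")
  case True
  have "homeomorphic_map ritter_space ritter_space id"
    by simp
  then show ?thesis using True by blast
next
  case False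
  have "f ` A = B" "inj_on f A" using assms(3) by (auto simp: bij_betw_def)
  then show ?thesis
    using theta_discrete_homeomorphism[of "\<lambda>a. a" A f] assms False by auto
qed

end
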